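(* Assume (A). If $d = \tilde{\omega}\big(\max(n^{3/2}p,\,n)\big)$, then $$\mathsf{TV}\Big(\mathsf{RGG}(n,\mathbb{T}^d,\mathsf{Unif},\sigma^\infty_p,p),\ \mathsf{G}(n,p)\Big) = o(1)\quad\text{as } n\to\infty.$$
   Context: Torus: $\mathbb{T}^d=\mathbb{R}^d/2\mathbb{Z}^d$, i.e. a product of $d$ circles of circumference $2$, with the uniform (Haar) probability measure $\mathsf{Unif}$. For $x,y$ on a circle of circumference 2, $|x-y|_C\in[0,1]$ is the circular distance (length of the shorter arc). For $1\le q<\infty$, $\|\mathbf{x}-\mathbf{y}\|_q=(\sum_{i=1}^d|x_i-y_i|_C^q)^{1/q}$, and $\|\mathbf{x}-\mathbf{y}\|_\infty=\max_i|x_i-y_i|_C$. For $p\in[0,1]$ and $q\in[1,\infty]$, $\tau^q_p$ is the value with $\mathbf{P}_{\mathbf{x},\mathbf{y}\text{ iid }\mathsf{Unif}}[\|\mathbf{x}-\mathbf{y}\|_q\le\tau^q_p]=p$, and $\sigma^q_p(\mathbf{x},\mathbf{y})=\mathbb{1}[\|\mathbf{x}-\mathbf{y}\|_q\le\tau^q_p]$. The random geometric graph $\mathsf{RGG}(n,\mathbb{T}^d,\mathsf{Unif},\sigma^q_p,p)$ on vertex set $[n]$: sample $\mathbf{x}^1,\dots,\mathbf{x}^n$ iid uniform on $\mathbb{T}^d$ and join $i,j$ iff $\|\mathbf{x}^i-\mathbf{x}^j\|_q\le\tau^q_p$. $\mathsf{G}(n,p)$ is the Erdős–Rényi graph. Assumption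 (A): there are absolute constants $\delta,\epsilon>0$ with $n^{-1+\epsilon}\le p\le 1/2$ and $n^\delta\le d$. The notations $\tilde o,\tilde\omega,\tilde O$ hide polylogarithmic factors in $n$. *)

theory Defs
  imports "HOL-Probability.Probability"
begin

text \<open>Circular distance on a circle of circumference 2 (reals taken mod 2).\<close>
definition circ_dist :: "real \<Rightarrow> real \<Rightarrow> real" where
  "circ_dist a b = (let t = 2 * frac ((a - b) / 2) in min t (2 - t))"

text \<open>Points of the torus R^d / 2Z^d: coordinates i < d, representatives in [0,2).\<close>
definition torus_unif :: "nat \<Rightarrow> (nat \<Rightarrow> real) measure" where
  "torus_unif d = PiM {..<d} (\<lambda>_. uniform_measure lborel {0..<2})"

definition linf_dist :: "nat \<Rightarrow> (nat \<Rightarrow> real) \<Rightarrow> (nat \<Rightarrow> real) \<Rightarrow> real" where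
  "linf_dist d x y = Max ({0} \<union> (\<lambda>i. circ_dist (x i) (y i)) ` {..<d})"

definition tau_inf :: "nat \<Rightarrow> real \<Rightarrow> real" where
  "tau_inf d p = (THE t. 0 \<le> t \<and> t \<le> 1 \<and>
      measure (torus_unif d \<Otimes>\<^sub>M torus_unif d)
        {xy \<in> space (torus_unif d \<Otimes>\<^sub>M torus_unif d). linf_dist d (fst xy) (snd xy) \<le> t} = p)"

text \<open>Graphs on vertex set {0..<n}: edge sets of pairs (i,j) with i < j < n.\<close>
definition all_pairs :: "nat \<Rightarrow> (nat \<times> nat) set" where
  "all_pairs n = {(i, j). i < j \<and> j < n}"

definition graphs :: "nat \<Rightarrow> (nat \<times> nat) set set" where
  "graphs n = Pow (all_pairs n)"

definition latent_points :: "nat \<Rightarrow> nat \<Rightarrow> (nat \<Rightarrow> nat \<Rightarrow> real) measure" where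
  "latent_points n d = PiM {..<n} (\<lambda>_. torus_unif d)"

definition rgg_graph :: "nat \<Rightarrow> nat \<Rightarrow> real \<Rightarrow> (nat \<Rightarrow> nat \<Rightarrow> real) \<Rightarrow> (nat \<times> nat) set" where
  "rgg_graph n d t X = {(i, j) \<in> all_pairs n. linf_dist d (X i) (X j) \<le> t}"

definition rgg_prob :: "nat \<Rightarrow> nat \<Rightarrow> real \<Rightarrow> (nat \<times> nat) set \<Rightarrow> real" where
  "rgg_prob n d p E = measure (latent_points n d)
     {X \<in> space (latent_points n d). rgg_graph n d (tau_inf d p) X = E}"

definition gnp_prob :: "nat \<Rightarrow> real \<Rightarrow> (nat \<times> nat) set \<Rightarrow> real" where
  "gnp_prob n p E = p ^ card E * (1 - p) ^ (card (all_pairs n) - card E)"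

definition tv_fin :: "'a set \<Rightarrow> ('a \<Rightarrow> real) \<Rightarrow> ('a \<Rightarrow> real) \<Rightarrow> real" where
  "tv_fin S f g = (1/2) * (\<Sum>x\<in>S. \<bar>f x - g x\<bar>)"

definition tv_rgg_gnp :: "nat \<Rightarrow> nat \<Rightarrow> real \<Rightarrow> real" where
  "tv_rgg_gnp n d p = tv_fin (graphs n) (rgg_prob n d p) (gnp_prob n p)"

end

theory Submission
  imports Defs
begin

text \<open>
  The divergence KL(RGG || G(n,p)) is bounded by revealing the vertices one at a time. Given the
  labels of the first \<open>k\<close> vertices, the chi-square divergence of the next vertex's neighbourhood
  from \<open>k\<close> independent \<open>p\<close>-coins averages to \<open>E (1 - q + q c / p\<^sup>2)\<^sup>k - 1\<close>, where \<open>q = p / (1 - p)\<close>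
  and \<open>c\<close> is the codegree of two random points: the probability that a third is joined to both.
  This is \<open>E (c / p\<^sup>2)\<^sup>B - 1\<close> with \<open>B\<close> binomial(\<open>k\<close>, \<open>q\<close>). For the max-distance \<open>c\<close> is a product over
  the \<open>d\<close> coordinates, so each moment \<open>E (c / p\<^sup>2)\<^sup>j\<close> is the \<open>d\<close>-th power of its value on one circle.
  There \<open>c / \<tau>\<^sup>2\<close> has mean 1 and variance \<open>O(u\<^sup>3)\<close> for \<open>u = 1 - \<tau> = 1 - p\<^bsup>1/d\<^esup> \<le> ln n / d\<close>, hence
  \<open>E (c / p\<^sup>2)\<^sup>j \<le> 1 + O(j\<^sup>2 d u\<^sup>3)\<close> as long as \<open>n u\<close> and \<open>n\<^sup>2 d u\<^sup>3\<close> are small, which is where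
  \<open>d \<gg> n\<close> enters. Summing the binomial second moments gives KL = \<open>O(n\<^sup>3 p\<^sup>2 (ln n)\<^sup>3 / d\<^sup>2)\<close>.
\<close>

section \<open>Divergences between weights on a finite set\<close>

definition hellinger_sq :: "'a set \<Rightarrow> ('a \<Rightarrow> real) \<Rightarrow> ('a \<Rightarrow> real) \<Rightarrow> real" where
  "hellinger_sq S f g = (\<Sum>x\<in>S. (sqrt (f x) - sqrt (g x))\<^sup>2)"

definition kl_fin :: "'a set \<Rightarrow> ('a \<Rightarrow> real) \<Rightarrow> ('a \<Rightarrow> real) \<Rightarrow> real" where
  "kl_fin S f g = (\<Sum>x\<in>S. f x * ln (f x / g x))"

definition chi_square_fin :: "'a set \<Rightarrow> ('a \<Rightarrow> real) \<Rightarrow> ('a \<Rightarrow> real) \<Rightarrow> real" where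
  "chi_square_fin S f g = (\<Sum>x\<in>S. (f x)\<^sup>2 / g x) - 1"

lemma tv_fin_le_sqrt_hellinger_sq:
  assumes "\<And>x. x \<in> S \<Longrightarrow> 0 \<le> f x" "\<And>x. x \<in> S \<Longrightarrow> 0 \<le> g x" "sum f S = 1" "sum g S = 1"
  shows "tv_fin S f g \<le> sqrt (hellinger_sq S f g)"
proof -
  define K where "K = (\<Sum>x\<in>S. (sqrt (f x) + sqrt (g x))\<^sup>2)"
  have "K \<le> (\<Sum>x\<in>S. 2 * f x + 2 * g x)"
    unfolding K_def
  proof (rule sum_mono)
    fix x assume "x \<in> S"
    moreover have "0 \<le> (sqrt (f x) - sqrt (g x))\<^sup>2" by simp
    ultimately show "(sqrt (f x) + sqrt (g x))\<^sup>2 \<le> 2 * f x + 2 * g x"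
      using assms(1,2) by (simp add: power2_diff power2_sum)
  qed
  also have "\<dots> = 4" using assms(3,4) by (simp add: sum.distrib flip: sum_distrib_left)
  finally have "sqrt K \<le> sqrt 4" by (rule real_sqrt_le_mono)
  have factor: "\<bar>f x - g x\<bar> = \<bar>sqrt (f x) - sqrt (g x)\<bar> * \<bar>sqrt (f x) + sqrt (g x)\<bar>"
    if "x \<in> S" for x
  proof -
    have "f x - g x = (sqrt (f x) - sqrt (g x)) * (sqrt (f x) + sqrt (g x))"
      using assms(1,2)[OF that] by (simp add: algebra_simps)
    then show ?thesis by (simp add: abs_mult)
  qed
  have "(\<Sum>x\<in>S. \<bar>f x - g x\<bar>) = (\<Sum>x\<in>S. \<bar>sqrt (f x) - sqrt (g x)\<bar> * \<bar>sqrt (f x) + sqrt (g x)\<bar>)"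
    by (intro sum.cong refl factor)
  also have "\<dots> \<le> L2_set (\<lambda>x. sqrt (f x) - sqrt (g x)) S * L2_set (\<lambda>x. sqrt (f x) + sqrt (g x)) S"
    by (rule L2_set_mult_ineq)
  also have "\<dots> = sqrt (hellinger_sq S f g) * sqrt K"
    by (simp add: L2_set_def hellinger_sq_def K_def)
  also have "\<dots> \<le> sqrt (hellinger_sq S f g) * sqrt 4"
    using \<open>sqrt K \<le> sqrt 4\<close> by (intro mult_left_mono) (auto simp: hellinger_sq_def sum_nonneg)
  finally show ?thesis by (simp add: tv_fin_def)
qed

lemma hellinger_sq_le_kl_fin:
  assumes f: "\<And>x. x \<in> S \<Longrightarrow> 0 \<le> f x" and g: "\<And>x. x \<in> S \<Longrightarrow> 0 < g x" and "sum f S = sum g S"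
  shows "hellinger_sq S f g \<le> kl_fin S f g"
proof -
  have pointwise: "(sqrt (f x) - sqrt (g x))\<^sup>2 \<le> f x * ln (f x / g x) + (g x - f x)" if "x \<in> S" for x
  proof (cases "f x = 0")
    case True
    then show ?thesis using g[OF that] by simp
  next
    case False
    then have pos: "0 < f x" "0 < g x" using f[OF that] g[OF that] by auto
    define r where "r = sqrt (g x / f x)"
    have "0 < r" using pos by (simp add: r_def)
    have "ln (f x / g x) = - 2 * ln r" using pos by (simp add: r_def ln_sqrt ln_div)
    moreover have "ln r \<le> r - 1" using \<open>0 < r\<close> by (rule ln_le_minus_one)
    ultimately have "f x * (2 - 2 * r) \<le> f x * ln (f x / g x)"
      using pos by (intro mult_left_mono) auto
    moreover have "f x * r = sqrt (f x) * sqrt (g x)"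
      using pos by (simp add: r_def real_sqrt_divide field_simps)
    ultimately show ?thesis using pos by (simp add: power2_diff algebra_simps)
  qed
  have "hellinger_sq S f g \<le> (\<Sum>x\<in>S. f x * ln (f x / g x) + (g x - f x))"
    unfolding hellinger_sq_def by (intro sum_mono pointwise)
  then show ?thesis using assms(3) by (simp add: kl_fin_def sum.distrib sum_subtractf)
qed

lemma kl_fin_le_chi_square_fin:
  assumes f: "\<And>x. x \<in> S \<Longrightarrow> 0 \<le> f x" and g: "\<And>x. x \<in> S \<Longrightarrow> 0 < g x" and "sum f S = 1"
  shows "kl_fin S f g \<le> chi_square_fin S f g"
proof -
  have pointwise: "f x * ln (f x / g x) \<le> (f x)\<^sup>2 / g x - f x" if "x \<in> S" for x
  proof (cases "f x = 0")
    case False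
    then have "f x * ln (f x / g x) \<le> f x * (f x / g x - 1)"
      using f[OF that] g[OF that] by (intro mult_left_mono ln_le_minus_one) auto
    then show ?thesis by (simp add: power2_eq_square algebra_simps)
  qed simp
  have "kl_fin S f g \<le> (\<Sum>x\<in>S. (f x)\<^sup>2 / g x - f x)"
    unfolding kl_fin_def by (intro sum_mono pointwise)
  then show ?thesis using assms(3) by (simp add: chi_square_fin_def sum_subtractf)
qed

lemma kl_fin_reindex_bij_betw:
  assumes "bij_betw \<phi> S T"
  shows "kl_fin T f g = kl_fin S (\<lambda>x. f (\<phi> x)) (\<lambda>x. g (\<phi> x))"
  unfolding kl_fin_def using assms by (rule sum.reindex_bij_betw[symmetric])

lemma kl_fin_chain_rule:
  assumes "finite B" and f: "\<And>a b. a \<in> A \<Longrightarrow> b \<in> B \<Longrightarrow> 0 \<le> f a b"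
    and g: "\<And>a. a \<in> A \<Longrightarrow> 0 < g a" and h: "\<And>b. b \<in> B \<Longrightarrow> 0 < h b"
    and marginal: "\<And>a. a \<in> A \<Longrightarrow> f\<^sub>1 a = (\<Sum>b\<in>B. f a b)"
  shows "kl_fin (A \<times> B) (\<lambda>(a, b). f a b) (\<lambda>(a, b). g a * h b) =
    kl_fin A f\<^sub>1 g + (\<Sum>a\<in>A. f\<^sub>1 a * kl_fin B (\<lambda>b. f a b / f\<^sub>1 a) h)"
proof -
  have split_ln: "f a b * ln (f a b / (g a * h b)) =
      f a b * ln (f\<^sub>1 a / g a) + f\<^sub>1 a * (f a b / f\<^sub>1 a * ln (f a b / f\<^sub>1 a / h b))"
    if a: "a \<in> A" and b: "b \<in> B" for a b
  proof (cases "f a b = 0")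
    case False
    then have "0 < f a b" using f[OF a b] by simp
    moreover have "f a b \<le> f\<^sub>1 a"
      unfolding marginal[OF a] using b f[OF a] \<open>finite B\<close> by (intro member_le_sum) auto
    ultimately have pos: "0 < f a b" "0 < f\<^sub>1 a" by auto
    then have "ln (f a b / (g a * h b)) = ln (f\<^sub>1 a / g a) + ln (f a b / f\<^sub>1 a / h b)"
      using g[OF a] h[OF b] by (simp add: ln_div ln_mult)
    then show ?thesis using pos by (simp add: algebra_simps)
  qed simp
  have "kl_fin (A \<times> B) (\<lambda>(a, b). f a b) (\<lambda>(a, b). g a * h b) =
      (\<Sum>a\<in>A. \<Sum>b\<in>B. f a b * ln (f a b / (g a * h b)))"
    by (simp add: kl_fin_def sum.cartesian_product split_def)
  also have "\<dots> = (\<Sum>a\<in>A. (\<Sum>b\<in>B. f a b) * ln (f\<^sub>1 a / g a)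
      + f\<^sub>1 a * kl_fin B (\<lambda>b. f a b / f\<^sub>1 a) h)"
    by (simp add: split_ln sum.distrib kl_fin_def sum_distrib_left sum_distrib_right cong: sum.cong)
  finally show ?thesis by (simp add: kl_fin_def sum.distrib marginal cong: sum.cong)
qed

text \<open>
  Each square satisfies \<open>v\<^sup>2 \<ge> 2 c v - c\<^sup>2\<close>, with equality in the mean when \<open>c\<close> is the weighted mean
  of \<open>v\<close>.
\<close>

lemma chi_square_fin_mixture_le:
  fixes w :: "'x \<Rightarrow> real" and v :: "'b \<Rightarrow> 'x \<Rightarrow> real"
  assumes h: "\<And>b. b \<in> B \<Longrightarrow> 0 < h b" and w: "\<And>x. x \<in> space M \<Longrightarrow> 0 \<le> w x"
    and int: "integrable M w" "\<And>b. b \<in> B \<Longrightarrow> integrable M (\<lambda>x. w x * v b x)"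
      "\<And>b. b \<in> B \<Longrightarrow> integrable M (\<lambda>x. w x * (v b x)\<^sup>2)"
    and m: "m = (\<integral>x. w x \<partial>M)"
  shows "m * chi_square_fin B (\<lambda>b. (\<integral>x. w x * v b x \<partial>M) / m) h \<le>
    (\<integral>x. w x * chi_square_fin B (\<lambda>b. v b x) h \<partial>M)"
proof -
  have second_moment: "m * ((\<integral>x. w x * v b x \<partial>M) / m)\<^sup>2 \<le> (\<integral>x. w x * (v b x)\<^sup>2 \<partial>M)"
    if b: "b \<in> B" for b
  proof -
    define c where "c = (\<integral>x. w x * v b x \<partial>M) / m"
    have "m * c\<^sup>2 = 2 * c * (\<integral>x. w x * v b x \<partial>M) - c\<^sup>2 * m"
      by (cases "m = 0") (auto simp: c_def power2_eq_square)
    also have "\<dots> = (\<integral>x. 2 * c * (w x * v b x) - c\<^sup>2 * w x \<partial>M)"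
      using int(1) int(2)[OF b] by (simp add: m)
    also have "\<dots> \<le> (\<integral>x. w x * (v b x)\<^sup>2 \<partial>M)"
    proof (rule integral_mono)
      fix x assume "x \<in> space M"
      then have "0 \<le> w x * (v b x - c)\<^sup>2" using w by simp
      then show "2 * c * (w x * v b x) - c\<^sup>2 * w x \<le> w x * (v b x)\<^sup>2"
        by (simp add: power2_diff algebra_simps)
    qed (use int(1) int(2,3)[OF b] in auto)
    finally show ?thesis unfolding c_def .
  qed
  have "m * chi_square_fin B (\<lambda>b. (\<integral>x. w x * v b x \<partial>M) / m) h =
      (\<Sum>b\<in>B. m * ((\<integral>x. w x * v b x \<partial>M) / m)\<^sup>2 / h b) - m"
    by (simp add: chi_square_fin_def right_diff_distrib sum_distrib_left)
  also have "\<dots> \<le> (\<Sum>b\<in>B. (\<integral>x. w x * (v b x)\<^sup>2 \<partial>M) / h b) - m"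
    using h
    by (intro diff_right_mono sum_mono divide_right_mono second_moment) (auto intro: less_imp_le)
  also have "\<dots> = (\<integral>x. (\<Sum>b\<in>B. w x * (v b x)\<^sup>2 / h b) - w x \<partial>M)"
    using int by (simp add: m)
  also have "\<dots> = (\<integral>x. w x * chi_square_fin B (\<lambda>b. v b x) h \<partial>M)"
    by (simp add: chi_square_fin_def right_diff_distrib sum_distrib_left)
  finally show ?thesis .
qed

lemma sum_integral_mult_eq_integral:
  fixes w :: "'x \<Rightarrow> real" and v :: "'b \<Rightarrow> 'x \<Rightarrow> real"
  assumes "\<And>b. b \<in> B \<Longrightarrow> integrable M (\<lambda>x. w x * v b x)"
    and sum_v: "\<And>x. x \<in> space M \<Longrightarrow> (\<Sum>b\<in>B. v b x) = 1"
  shows "(\<Sum>b\<in>B. \<integral>x. w x * v b x \<partial>M) = (\<integral>x. w x \<partial>M)"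
proof -
  have "(\<Sum>b\<in>B. \<integral>x. w x * v b x \<partial>M) = (\<integral>x. w x * (\<Sum>b\<in>B. v b x) \<partial>M)"
    using assms(1) by (simp add: sum_distrib_left)
  also have "\<dots> = (\<integral>x. w x \<partial>M)"
    by (intro Bochner_Integration.integral_cong refl) (simp add: sum_v)
  finally show ?thesis .
qed

lemma kl_fin_mixture_le_chi_square_fin:
  fixes w :: "'x \<Rightarrow> real" and v :: "'b \<Rightarrow> 'x \<Rightarrow> real"
  assumes h: "\<And>b. b \<in> B \<Longrightarrow> 0 < h b" and w: "\<And>x. x \<in> space M \<Longrightarrow> 0 \<le> w x"
    and v: "\<And>b x. b \<in> B \<Longrightarrow> x \<in> space M \<Longrightarrow> 0 \<le> v b x"
    and sum_v: "\<And>x. x \<in> space M \<Longrightarrow> (\<Sum>b\<in>B. v b x) = 1"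
    and int: "integrable M w" "\<And>b. b \<in> B \<Longrightarrow> integrable M (\<lambda>x. w x * v b x)"
      "\<And>b. b \<in> B \<Longrightarrow> integrable M (\<lambda>x. w x * (v b x)\<^sup>2)"
    and m: "m = (\<integral>x. w x \<partial>M)"
  shows "m * kl_fin B (\<lambda>b. (\<integral>x. w x * v b x \<partial>M) / m) h \<le>
    (\<integral>x. w x * chi_square_fin B (\<lambda>b. v b x) h \<partial>M)"
proof -
  let ?f = "\<lambda>b. \<integral>x. w x * v b x \<partial>M"
  have "0 \<le> m" unfolding m using w by (intro Bochner_Integration.integral_nonneg) auto
  have f_nonneg: "0 \<le> ?f b" if "b \<in> B" for b
    using that w v by (intro Bochner_Integration.integral_nonneg) auto
  have sum_f: "(\<Sum>b\<in>B. ?f b) = m"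
    unfolding m by (intro sum_integral_mult_eq_integral int sum_v)
  have "m * kl_fin B (\<lambda>b. ?f b / m) h \<le> m * chi_square_fin B (\<lambda>b. ?f b / m) h"
  proof (cases "m = 0")
    case False
    then show ?thesis using \<open>0 \<le> m\<close> f_nonneg h sum_f
      by (intro mult_left_mono kl_fin_le_chi_square_fin) (auto simp flip: sum_divide_distrib)
  qed simp
  also have "\<dots> \<le> (\<integral>x. w x * chi_square_fin B (\<lambda>b. v b x) h \<partial>M)"
    by (intro chi_square_fin_mixture_le h w int m)
  finally show ?thesis .
qed

lemma (in prob_space) integrable_bounded:
  fixes f :: "'a \<Rightarrow> real"
  assumes "f \<in> borel_measurable M" "\<And>x. x \<in> space M \<Longrightarrow> \<bar>f x\<bar> \<le> C"
  shows "integrable M f"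
  using assms by (intro integrable_const_bound[where B = C]) (auto intro: AE_I2)

text \<open>
  The outcomes \<open>a\<close> and \<open>b\<close> are conditionally independent given a latent variable \<open>x\<close> with law \<open>M\<close>.
\<close>

lemma (in prob_space) kl_fin_mixture_le:
  fixes w :: "'b \<Rightarrow> 'a \<Rightarrow> real" and v :: "'c \<Rightarrow> 'a \<Rightarrow> real"
  assumes fin: "finite A" "finite B"
    and g: "\<And>a. a \<in> A \<Longrightarrow> 0 < g a" and h: "\<And>b. b \<in> B \<Longrightarrow> 0 < h b"
    and w [measurable]: "\<And>a. a \<in> A \<Longrightarrow> w a \<in> borel_measurable M"
    and w_nonneg: "\<And>a x. a \<in> A \<Longrightarrow> x \<in> space M \<Longrightarrow> 0 \<le> w a x"
    and sum_w: "\<And>x. x \<in> space M \<Longrightarrow> (\<Sum>a\<in>A. w a x) = 1"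
    and v [measurable]: "\<And>b. b \<in> B \<Longrightarrow> v b \<in> borel_measurable M"
    and v_nonneg: "\<And>b x. b \<in> B \<Longrightarrow> x \<in> space M \<Longrightarrow> 0 \<le> v b x"
    and sum_v: "\<And>x. x \<in> space M \<Longrightarrow> (\<Sum>b\<in>B. v b x) = 1"
  shows "kl_fin (A \<times> B) (\<lambda>(a, b). \<integral>x. w a x * v b x \<partial>M) (\<lambda>(a, b). g a * h b) \<le>
    kl_fin A (\<lambda>a. \<integral>x. w a x \<partial>M) g + (\<integral>x. chi_square_fin B (\<lambda>b. v b x) h \<partial>M)"
proof -
  let ?w = "\<lambda>a. \<integral>x. w a x \<partial>M" and ?f = "\<lambda>a b. \<integral>x. w a x * v b x \<partial>M"
  let ?\<chi> = "\<lambda>x. chi_square_fin B (\<lambda>b. v b x) h"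
  have w_le_1: "w a x \<le> 1" if "a \<in> A" "x \<in> space M" for a x
    unfolding sum_w[OF that(2), symmetric] using that w_nonneg fin by (intro member_le_sum) auto
  have v_le_1: "v b x \<le> 1" if "b \<in> B" "x \<in> space M" for b x
    unfolding sum_v[OF that(2), symmetric] using that v_nonneg fin by (intro member_le_sum) auto
  have int_w: "integrable M (w a)" if "a \<in> A" for a
    using w_nonneg[OF that] w_le_1[OF that] that by (intro integrable_bounded[where C = 1]) auto
  have int_wv: "integrable M (\<lambda>x. w a x * v b x)" "integrable M (\<lambda>x. w a x * (v b x)\<^sup>2)"
    if "a \<in> A" "b \<in> B" for a b
    using w_nonneg[OF that(1)] w_le_1[OF that(1)] v_nonneg[OF that(2)] v_le_1[OF that(2)] that
    by (auto intro!: integrable_bounded[where C = 1] mult_le_one simp: abs_mult power_le_one)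
  have int_w\<chi>: "integrable M (\<lambda>x. w a x * ?\<chi> x)" if "a \<in> A" for a
    unfolding chi_square_fin_def right_diff_distrib sum_distrib_left
    using int_w[OF that] int_wv[OF that] by simp
  have marginal: "?w a = (\<Sum>b\<in>B. ?f a b)" if "a \<in> A" for a
    using int_wv(1)[OF that] sum_v by (intro sum_integral_mult_eq_integral[symmetric])
  have f_nonneg: "0 \<le> ?f a b" if "a \<in> A" "b \<in> B" for a b
    using that w_nonneg v_nonneg by (intro Bochner_Integration.integral_nonneg) auto
  have conditional: "?w a * kl_fin B (\<lambda>b. ?f a b / ?w a) h \<le> (\<integral>x. w a x * ?\<chi> x \<partial>M)"
    if "a \<in> A" for a
    using that by (intro kl_fin_mixture_le_chi_square_fin h w_nonneg v_nonneg sum_v int_w int_wv) auto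
  have "kl_fin (A \<times> B) (\<lambda>(a, b). ?f a b) (\<lambda>(a, b). g a * h b) =
      kl_fin A ?w g + (\<Sum>a\<in>A. ?w a * kl_fin B (\<lambda>b. ?f a b / ?w a) h)"
    by (intro kl_fin_chain_rule fin f_nonneg g h marginal)
  also have "\<dots> \<le> kl_fin A ?w g + (\<Sum>a\<in>A. \<integral>x. w a x * ?\<chi> x \<partial>M)"
    by (intro add_left_mono sum_mono conditional)
  also have "(\<Sum>a\<in>A. \<integral>x. w a x * ?\<chi> x \<partial>M) = (\<integral>x. (\<Sum>a\<in>A. w a x) * ?\<chi> x \<partial>M)"
    using int_w\<chi> by (simp add: sum_distrib_right)
  also have "\<dots> = (\<integral>x. ?\<chi> x \<partial>M)"
    by (intro Bochner_Integration.integral_cong refl) (simp add: sum_w)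
  finally show ?thesis .
qed

section \<open>Random subsets\<close>

definition random_subset_prob :: "'a set \<Rightarrow> ('a \<Rightarrow> real) \<Rightarrow> 'a set \<Rightarrow> real" where
  "random_subset_prob A f B = (\<Prod>a\<in>A. if a \<in> B then f a else 1 - f a)"

lemma sum_Pow_prod_if:
  fixes f g :: "'a \<Rightarrow> 'b :: comm_semiring_1"
  assumes "finite A"
  shows "(\<Sum>B\<in>Pow A. \<Prod>a\<in>A. if a \<in> B then f a else g a) = (\<Prod>a\<in>A. f a + g a)"
proof -
  have "(\<Prod>a\<in>A. if a \<in> B then f a else g a) = (\<Prod>a\<in>B. f a) * (\<Prod>a\<in>A - B. g a)" if "B \<in> Pow A" for B
    using that assms by (simp add: prod.If_cases Int_absorb1 Diff_eq)
  then show ?thesis using assms by (simp add: prod_add)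
qed

lemma sum_random_subset_prob: "finite A \<Longrightarrow> (\<Sum>B\<in>Pow A. random_subset_prob A f B) = 1"
  by (simp add: random_subset_prob_def sum_Pow_prod_if)

lemma sum_random_subset_prob_mult_divide:
  assumes "finite A"
  shows "(\<Sum>B\<in>Pow A. random_subset_prob A f B * random_subset_prob A g B / random_subset_prob A h B) =
    (\<Prod>a\<in>A. f a * g a / h a + (1 - f a) * (1 - g a) / (1 - h a))"
proof -
  have "random_subset_prob A f B * random_subset_prob A g B / random_subset_prob A h B =
      (\<Prod>a\<in>A. if a \<in> B then f a * g a / h a else (1 - f a) * (1 - g a) / (1 - h a))" for B
    unfolding random_subset_prob_def prod.distrib[symmetric] prod_dividef[symmetric]
    by (intro prod.cong) auto
  then show ?thesis using assms by (simp add: sum_Pow_prod_if)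
qed

lemma random_subset_prob_bounds:
  assumes "\<And>a. a \<in> A \<Longrightarrow> 0 \<le> f a \<and> f a \<le> 1"
  shows "0 \<le> random_subset_prob A f B" "random_subset_prob A f B \<le> 1"
  unfolding random_subset_prob_def using assms by (auto intro!: prod_nonneg prod_le_1)

lemma random_subset_prob_pos:
  assumes "\<And>a. a \<in> A \<Longrightarrow> 0 < f a \<and> f a < 1"
  shows "0 < random_subset_prob A f B"
  unfolding random_subset_prob_def using assms by (auto intro!: prod_pos)

lemma random_subset_prob_const:
  assumes "finite A" "B \<subseteq> A"
  shows "random_subset_prob A (\<lambda>_. p) B = p ^ card B * (1 - p) ^ (card A - card B)"
  using assms by (simp add: random_subset_prob_def prod.If_cases Int_absorb1 card_Diff_subset
      finite_subset flip: Diff_eq)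

lemma random_subset_prob_of_bool:
  assumes "finite A" "B \<subseteq> A"
  shows "random_subset_prob A (\<lambda>a. of_bool (P a)) B = of_bool ({a \<in> A. P a} = B)"
proof (cases "{a \<in> A. P a} = B")
  case True
  then show ?thesis unfolding random_subset_prob_def by (auto intro!: prod.neutral)
next
  case False
  then obtain a where "a \<in> A" "P a \<noteq> (a \<in> B)" using \<open>B \<subseteq> A\<close> by blast
  then show ?thesis using False \<open>finite A\<close> by (auto simp: random_subset_prob_def intro!: bexI[of _ a])
qed

lemma random_subset_prob_Un:
  assumes "finite A" "finite A'" "A \<inter> A' = {}" "B \<subseteq> A" "B' \<subseteq> A'"
  shows "random_subset_prob (A \<union> A') f (B \<union> B') = random_subset_prob A f B * random_subset_prob A' f B'"
proof -
  have "random_subset_prob A f (B \<union> B') = random_subset_prob A f B"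
    "random_subset_prob A' f (B \<union> B') = random_subset_prob A' f B'"
    unfolding random_subset_prob_def using assms(3-5) by (auto intro!: prod.cong)
  then show ?thesis using assms(1-3) by (simp add: random_subset_prob_def prod.union_disjoint)
qed

lemma random_subset_prob_image:
  assumes "inj \<phi>"
  shows "random_subset_prob (\<phi> ` A) f (\<phi> ` B) = random_subset_prob A (\<lambda>a. f (\<phi> a)) B"
  using assms by (simp add: random_subset_prob_def prod.reindex inj_on_subset inj_image_mem_iff)

section \<open>Graphs grown one vertex at a time\<close>

lemma finite_all_pairs [simp]: "finite (all_pairs n)"
  by (rule finite_subset[of _ "{..<n} \<times> {..<n}"]) (auto simp: all_pairs_def)

lemma finite_graphs [simp]: "finite (graphs n)"
  by (simp add: graphs_def)

lemma all_pairs_Suc: "all_pairs (Suc k) = all_pairs k \<union> (\<lambda>i. (i, k)) ` {..<k}"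
  by (auto simp: all_pairs_def less_Suc_eq)

definition add_vertex :: "nat \<Rightarrow> (nat \<times> nat) set \<Rightarrow> nat set \<Rightarrow> (nat \<times> nat) set" where
  "add_vertex k E S = E \<union> (\<lambda>i. (i, k)) ` S"

lemma bij_betw_add_vertex:
  "bij_betw (\<lambda>(E, S). add_vertex k E S) (graphs k \<times> Pow {..<k}) (graphs (Suc k))"
  by (rule bij_betw_byWitness[where f' = "\<lambda>G. (G \<inter> all_pairs k, {i. (i, k) \<in> G})"])
    (fastforce simp: graphs_def all_pairs_def add_vertex_def less_Suc_eq)+

lemma random_subset_prob_add_vertex:
  assumes "E \<in> graphs k" "S \<subseteq> {..<k}"
  shows "random_subset_prob (all_pairs (Suc k)) f (add_vertex k E S) =
    random_subset_prob (all_pairs k) f E * random_subset_prob {..<k} (\<lambda>i. f (i, k)) S"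
proof -
  have "random_subset_prob (all_pairs (Suc k)) f (add_vertex k E S) =
      random_subset_prob (all_pairs k) f E *
      random_subset_prob ((\<lambda>i. (i, k)) ` {..<k}) f ((\<lambda>i. (i, k)) ` S)"
    unfolding all_pairs_Suc add_vertex_def
    using assms by (intro random_subset_prob_Un) (auto simp: graphs_def, auto simp: all_pairs_def)
  then show ?thesis by (simp add: random_subset_prob_image inj_def)
qed

lemma gnp_prob_eq_random_subset_prob:
  "E \<in> graphs n \<Longrightarrow> gnp_prob n p E = random_subset_prob (all_pairs n) (\<lambda>_. p) E"
  by (simp add: gnp_prob_def graphs_def random_subset_prob_const)

lemma gnp_prob_add_vertex:
  assumes "E \<in> graphs k" "S \<subseteq> {..<k}"
  shows "gnp_prob (Suc k) p (add_vertex k E S) = gnp_prob k p E * random_subset_prob {..<k} (\<lambda>_. p) S"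
proof -
  have "add_vertex k E S \<in> graphs (Suc k)"
    using bij_betw_apply[OF bij_betw_add_vertex, of "(E, S)"] assms by simp
  then show ?thesis
    using assms by (simp add: gnp_prob_eq_random_subset_prob random_subset_prob_add_vertex)
qed

lemma sum_gnp_prob: "(\<Sum>E\<in>graphs n. gnp_prob n p E) = 1"
proof -
  have "(\<Sum>E\<in>graphs n. gnp_prob n p E) = (\<Sum>E\<in>graphs n. random_subset_prob (all_pairs n) (\<lambda>_. p) E)"
    by (intro sum.cong refl gnp_prob_eq_random_subset_prob)
  then show ?thesis by (simp add: graphs_def sum_random_subset_prob)
qed

lemma gnp_prob_pos: "0 < p \<Longrightarrow> p < 1 \<Longrightarrow> 0 < gnp_prob n p E"
  by (simp add: gnp_prob_def)

section \<open>Random graphs sampled from a graphon\<close>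

abbreviation power_measure :: "'a measure \<Rightarrow> nat \<Rightarrow> (nat \<Rightarrow> 'a) measure" where
  "power_measure M k \<equiv> PiM {..<k} (\<lambda>_. M)"

text \<open>
  The vertices carry independent labels with law \<open>M\<close>, and vertices labelled \<open>x\<close> and \<open>y\<close> are joined
  with probability \<open>W x y\<close>.
\<close>

definition cond_graph_prob :: "('a \<Rightarrow> 'a \<Rightarrow> real) \<Rightarrow> nat \<Rightarrow> (nat \<Rightarrow> 'a) \<Rightarrow> (nat \<times> nat) set \<Rightarrow> real" where
  "cond_graph_prob W k X E = random_subset_prob (all_pairs k) (\<lambda>(i, j). W (X i) (X j)) E"

definition cond_nbhd_prob :: "('a \<Rightarrow> 'a \<Rightarrow> real) \<Rightarrow> nat \<Rightarrow> (nat \<Rightarrow> 'a) \<Rightarrow> 'a \<Rightarrow> nat set \<Rightarrow> real" where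
  "cond_nbhd_prob W k X z S = random_subset_prob {..<k} (\<lambda>i. W (X i) z) S"

definition graph_prob :: "'a measure \<Rightarrow> ('a \<Rightarrow> 'a \<Rightarrow> real) \<Rightarrow> nat \<Rightarrow> (nat \<times> nat) set \<Rightarrow> real" where
  "graph_prob M W k E = (\<integral>X. cond_graph_prob W k X E \<partial>power_measure M k)"

definition nbhd_prob :: "'a measure \<Rightarrow> ('a \<Rightarrow> 'a \<Rightarrow> real) \<Rightarrow> nat \<Rightarrow> (nat \<Rightarrow> 'a) \<Rightarrow> nat set \<Rightarrow> real" where
  "nbhd_prob M W k X S = (\<integral>z. cond_nbhd_prob W k X z S \<partial>M)"

definition nbhd_chi_square :: "'a measure \<Rightarrow> ('a \<Rightarrow> 'a \<Rightarrow> real) \<Rightarrow> real \<Rightarrow> nat \<Rightarrow> real" where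
  "nbhd_chi_square M W p k = (\<integral>X. chi_square_fin (Pow {..<k}) (nbhd_prob M W k X)
     (random_subset_prob {..<k} (\<lambda>_. p)) \<partial>power_measure M k)"

definition codegree :: "'a measure \<Rightarrow> ('a \<Rightarrow> 'a \<Rightarrow> real) \<Rightarrow> 'a \<Rightarrow> 'a \<Rightarrow> real" where
  "codegree M W z z' = (\<integral>x. W x z * W x z' \<partial>M)"

definition codegree_moment :: "'a measure \<Rightarrow> ('a \<Rightarrow> 'a \<Rightarrow> real) \<Rightarrow> real \<Rightarrow> nat \<Rightarrow> real" where
  "codegree_moment M W p j = (\<integral>(z, z'). (codegree M W z z' / p\<^sup>2) ^ j \<partial>(M \<Otimes>\<^sub>M M))"

lemma cond_graph_prob_add_vertex:
  assumes "E \<in> graphs k" "S \<subseteq> {..<k}"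
  shows "cond_graph_prob W (Suc k) (X(k := z)) (add_vertex k E S) =
    cond_graph_prob W k X E * cond_nbhd_prob W k X z S"
proof -
  have "random_subset_prob (all_pairs k) (\<lambda>(i, j). W ((X(k := z)) i) ((X(k := z)) j)) E =
      cond_graph_prob W k X E"
    unfolding cond_graph_prob_def random_subset_prob_def
    by (rule prod.cong) (auto simp: all_pairs_def)
  moreover have "random_subset_prob {..<k} (\<lambda>i. W ((X(k := z)) i) ((X(k := z)) k)) S =
      cond_nbhd_prob W k X z S"
    unfolding cond_nbhd_prob_def random_subset_prob_def by (rule prod.cong) auto
  ultimately show ?thesis
    using random_subset_prob_add_vertex[OF assms] by (simp add: cond_graph_prob_def)
qed

lemma sum_cond_graph_prob: "(\<Sum>E\<in>graphs k. cond_graph_prob W k X E) = 1"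
  unfolding cond_graph_prob_def graphs_def by (rule sum_random_subset_prob) simp

lemma sum_cond_nbhd_prob: "(\<Sum>S\<in>Pow {..<k}. cond_nbhd_prob W k X z S) = 1"
  unfolding cond_nbhd_prob_def by (rule sum_random_subset_prob) simp

lemma sum_Bernstein_mult_le:
  assumes q: "0 \<le> q" "q \<le> 1" and "0 \<le> c"
    and m: "\<And>j. j \<le> k \<Longrightarrow> m j \<le> 1 + c * (real j)\<^sup>2"
  shows "(\<Sum>j\<le>k. Bernstein k j q * m j) \<le> 1 + c * (real k * q + (real k * q)\<^sup>2)"
proof -
  have "(\<Sum>j\<le>k. Bernstein k j q * m j) \<le> (\<Sum>j\<le>k. Bernstein k j q * (1 + c * (real j)\<^sup>2))"
    using q by (intro sum_mono mult_left_mono m Bernstein_nonneg) auto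
  also have "\<dots> = (\<Sum>j\<le>k. Bernstein k j q + c * (real j * (real j - 1) * Bernstein k j q
      + real j * Bernstein k j q))"
    by (intro sum.cong) (auto simp: algebra_simps power2_eq_square)
  also have "\<dots> = 1 + c * (real k * (real k - 1) * q\<^sup>2 + real k * q)"
    by (simp add: sum.distrib flip: sum_distrib_left)
  also have "\<dots> \<le> 1 + c * (real k * q + (real k * q)\<^sup>2)"
  proof -
    have "0 \<le> real k * q\<^sup>2" by simp
    then show ?thesis
      using \<open>0 \<le> c\<close> by (intro add_left_mono mult_left_mono) (auto simp: algebra_simps power2_eq_square)
  qed
  finally show ?thesis .
qed

lemma (in pair_sigma_finite) integral_pair_mult:
  fixes f g :: "_ \<Rightarrow> real"
  assumes "integrable (M1 \<Otimes>\<^sub>M M2) (\<lambda>(x, y). f x * g y)"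
  shows "(\<integral>(x, y). f x * g y \<partial>(M1 \<Otimes>\<^sub>M M2)) = (\<integral>x. f x \<partial>M1) * (\<integral>y. g y \<partial>M2)"
  unfolding integral_fst[OF assms, symmetric] by simp

locale regular_graphon = prob_space M for M :: "'a measure" +
  fixes W :: "'a \<Rightarrow> 'a \<Rightarrow> real" and p :: real
  assumes W_pair_measurable: "case_prod W \<in> borel_measurable (M \<Otimes>\<^sub>M M)"
    and W_nonneg [simp]: "0 \<le> W x y" and W_le_1 [simp]: "W x y \<le> 1"
    and W_sym: "W x y = W y x"
    and degree: "z \<in> space M \<Longrightarrow> (\<integral>x. W x z \<partial>M) = p"
begin

sublocale pair: pair_prob_space M M
  by unfold_locales

sublocale labels: product_prob_space "\<lambda>_ :: nat. M" UNIV
  by unfold_locales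

sublocale power: prob_space "power_measure M k" for k
  by (rule prob_space_PiM) (rule prob_space_axioms)

lemma W_measurable [measurable (raw)]:
  assumes "f \<in> measurable N M" "g \<in> measurable N M"
  shows "(\<lambda>w. W (f w) (g w)) \<in> borel_measurable N"
  using measurable_compose[OF measurable_Pair[OF assms] W_pair_measurable] by simp

lemma codegree_measurable [measurable (raw)]:
  assumes [measurable]: "f \<in> measurable N M" "g \<in> measurable N M"
  shows "(\<lambda>w. codegree M W (f w) (g w)) \<in> borel_measurable N"
  unfolding codegree_def by measurable

lemma integrable_W [simp]: "z \<in> space M \<Longrightarrow> integrable M (\<lambda>x. W x z)"
  by (rule integrable_bounded[where C = 1]) auto

lemma integrable_W_mult [simp]:
  assumes [measurable]: "z \<in> space M" "z' \<in> space M"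
  shows "integrable M (\<lambda>x. W x z * W x z')"
  by (rule integrable_bounded[where C = 1]) (auto simp: abs_mult mult_le_one)

lemma p_bounds: "0 \<le> p" "p \<le> 1"
proof -
  obtain z where z: "z \<in> space M" using not_empty by blast
  show "0 \<le> p" unfolding degree[OF z, symmetric] by simp
  show "p \<le> 1" unfolding degree[OF z, symmetric] using z
    by (intro integral_le_const) auto
qed

lemma codegree_nonneg: "0 \<le> codegree M W z z'"
  unfolding codegree_def by simp

lemma codegree_le:
  assumes "z \<in> space M" "z' \<in> space M"
  shows "codegree M W z z' \<le> p"
proof -
  have "codegree M W z z' \<le> (\<integral>x. W x z \<partial>M)"
    unfolding codegree_def using assms by (intro integral_mono) (auto simp: mult_left_le)
  then show ?thesis using assms by (simp add: degree)
qed

lemma integral_one_minus_W_mult: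
  assumes "z \<in> space M" "z' \<in> space M"
  shows "(\<integral>x. (1 - W x z) * (1 - W x z') \<partial>M) = 1 - 2 * p + codegree M W z z'"
proof -
  have "(\<integral>x. (1 - W x z) * (1 - W x z') \<partial>M) = (\<integral>x. 1 - W x z - W x z' + W x z * W x z' \<partial>M)"
    by (simp add: algebra_simps)
  then show ?thesis using assms by (simp add: codegree_def degree prob_space)
qed

lemma codegree_ge:
  assumes "z \<in> space M" "z' \<in> space M"
  shows "2 * p - 1 \<le> codegree M W z z'"
proof -
  have "0 \<le> (\<integral>x. (1 - W x z) * (1 - W x z') \<partial>M)" by simp
  then show ?thesis unfolding integral_one_minus_W_mult[OF assms] by simp
qed

lemma cond_graph_prob_bounds [simp]: "0 \<le> cond_graph_prob W k X E" "cond_graph_prob W k X E \<le> 1"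
  unfolding cond_graph_prob_def
  using random_subset_prob_bounds[of "all_pairs k" "\<lambda>(i, j). W (X i) (X j)"] by auto

lemma cond_nbhd_prob_bounds [simp]: "0 \<le> cond_nbhd_prob W k X z S" "cond_nbhd_prob W k X z S \<le> 1"
  unfolding cond_nbhd_prob_def
  using random_subset_prob_bounds[of "{..<k}" "\<lambda>i. W (X i) z"] by auto

lemma cond_graph_prob_measurable [measurable]:
  "(\<lambda>X. cond_graph_prob W k X E) \<in> borel_measurable (power_measure M k)"
  unfolding cond_graph_prob_def random_subset_prob_def
proof (intro borel_measurable_prod)
  fix e assume "e \<in> all_pairs k"
  then have [measurable]: "fst e \<in> {..<k}" "snd e \<in> {..<k}" by (auto simp: all_pairs_def)
  show "(\<lambda>X. if e \<in> E then (case e of (i, j) \<Rightarrow> W (X i) (X j))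
      else 1 - (case e of (i, j) \<Rightarrow> W (X i) (X j))) \<in> borel_measurable (power_measure M k)"
    unfolding split_def by measurable
qed

lemma cond_nbhd_prob_measurable [measurable (raw)]:
  assumes [measurable]: "f \<in> measurable N (power_measure M k)" "g \<in> measurable N M"
  shows "(\<lambda>w. cond_nbhd_prob W k (f w) (g w) S) \<in> borel_measurable N"
  unfolding cond_nbhd_prob_def random_subset_prob_def by measurable

lemma nbhd_prob_measurable [measurable]:
  "(\<lambda>X. nbhd_prob M W k X S) \<in> borel_measurable (power_measure M k)"
  unfolding nbhd_prob_def by measurable

lemma graph_prob_nonneg: "0 \<le> graph_prob M W k E"
  unfolding graph_prob_def by simp

lemma nbhd_prob_nonneg: "0 \<le> nbhd_prob M W k X S"
  unfolding nbhd_prob_def by simp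

lemma integrable_cond_graph_prob [simp]:
  "integrable (power_measure M k) (\<lambda>X. cond_graph_prob W k X E)"
  by (rule power.integrable_bounded[where C = 1]) auto

lemma sum_graph_prob: "(\<Sum>E\<in>graphs k. graph_prob M W k E) = 1"
proof -
  have "(\<Sum>E\<in>graphs k. graph_prob M W k E) =
      (\<integral>X. (\<Sum>E\<in>graphs k. cond_graph_prob W k X E) \<partial>power_measure M k)"
    by (simp add: graph_prob_def)
  then show ?thesis by (simp only: sum_cond_graph_prob) (simp add: power.prob_space)
qed

lemma sum_nbhd_prob:
  assumes X [measurable]: "X \<in> space (power_measure M k)"
  shows "(\<Sum>S\<in>Pow {..<k}. nbhd_prob M W k X S) = 1"
proof -
  have "integrable M (\<lambda>z. cond_nbhd_prob W k X z S)" for S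
    by (rule integrable_bounded[where C = 1]) auto
  then have "(\<Sum>S\<in>Pow {..<k}. nbhd_prob M W k X S) =
      (\<integral>z. (\<Sum>S\<in>Pow {..<k}. cond_nbhd_prob W k X z S) \<partial>M)"
    by (simp add: nbhd_prob_def)
  then show ?thesis by (simp only: sum_cond_nbhd_prob) (simp add: prob_space)
qed

lemma graph_prob_add_vertex:
  assumes "E \<in> graphs k" "S \<subseteq> {..<k}"
  shows "graph_prob M W (Suc k) (add_vertex k E S) =
    (\<integral>X. cond_graph_prob W k X E * nbhd_prob M W k X S \<partial>power_measure M k)"
proof -
  have "graph_prob M W (Suc k) (add_vertex k E S) =
      (\<integral>X. (\<integral>z. cond_graph_prob W (Suc k) (X(k := z)) (add_vertex k E S) \<partial>M) \<partial>power_measure M k)"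
    unfolding graph_prob_def lessThan_Suc
    by (intro labels.product_integral_insert)
      (use integrable_cond_graph_prob[of "Suc k"] in \<open>auto simp: lessThan_Suc\<close>)
  then show ?thesis using assms by (simp add: cond_graph_prob_add_vertex nbhd_prob_def)
qed

section \<open>Relative entropy to the Erdos-Renyi graph\<close>

lemma kl_fin_graph_prob_Suc_le:
  assumes p: "0 < p" "p < 1"
  shows "kl_fin (graphs (Suc k)) (graph_prob M W (Suc k)) (gnp_prob (Suc k) p) \<le>
    kl_fin (graphs k) (graph_prob M W k) (gnp_prob k p) + nbhd_chi_square M W p k"
proof -
  have "kl_fin (graphs (Suc k)) (graph_prob M W (Suc k)) (gnp_prob (Suc k) p) =
      kl_fin (graphs k \<times> Pow {..<k})
        (\<lambda>(E, S). \<integral>X. cond_graph_prob W k X E * nbhd_prob M W k X S \<partial>power_measure M k)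
        (\<lambda>(E, S). gnp_prob k p E * random_subset_prob {..<k} (\<lambda>_. p) S)"
    unfolding kl_fin_reindex_bij_betw[OF bij_betw_add_vertex]
    by (auto simp: kl_fin_def graph_prob_add_vertex gnp_prob_add_vertex intro!: sum.cong)
  also have "\<dots> \<le> kl_fin (graphs k) (graph_prob M W k) (gnp_prob k p) + nbhd_chi_square M W p k"
    unfolding graph_prob_def nbhd_chi_square_def using p
    by (intro power.kl_fin_mixture_le gnp_prob_pos random_subset_prob_pos nbhd_prob_nonneg)
      (auto simp: sum_cond_graph_prob sum_nbhd_prob)
  finally show ?thesis .
qed

lemma kl_fin_graph_prob_le:
  assumes "0 < p" "p < 1"
  shows "kl_fin (graphs n) (graph_prob M W n) (gnp_prob n p) \<le> (\<Sum>k<n. nbhd_chi_square M W p k)"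
proof (induction n)
  case 0
  have "graphs 0 = {{}}" by (auto simp: graphs_def all_pairs_def)
  then show ?case using sum_graph_prob[of 0] sum_gnp_prob[of 0 p] by (simp add: kl_fin_def)
next
  case (Suc n)
  then show ?case using kl_fin_graph_prob_Suc_le[OF assms, of n] by simp
qed

definition overlap :: "'a \<Rightarrow> 'a \<Rightarrow> 'a \<Rightarrow> real" where
  "overlap x z z' = W x z * W x z' / p + (1 - W x z) * (1 - W x z') / (1 - p)"

lemma overlap_measurable [measurable (raw)]:
  assumes [measurable]: "e \<in> measurable N M" "f \<in> measurable N M" "g \<in> measurable N M"
  shows "(\<lambda>w. overlap (e w) (f w) (g w)) \<in> borel_measurable N"
  unfolding overlap_def by measurable

lemma abs_overlap_le: "\<bar>overlap x z z'\<bar> \<le> 1 / p + 1 / (1 - p)"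
proof -
  have "\<bar>overlap x z z'\<bar> = overlap x z z'"
    using p_bounds by (simp add: overlap_def)
  also have "\<dots> \<le> 1 / p + 1 / (1 - p)"
    unfolding overlap_def using p_bounds by (intro add_mono divide_right_mono mult_le_one) auto
  finally show ?thesis .
qed

lemma abs_prod_overlap_le:
  "\<bar>\<Prod>i<k. overlap (X i) z z'\<bar> \<le> (1 / p + 1 / (1 - p)) ^ k"
proof -
  have "\<bar>\<Prod>i<k. overlap (X i) z z'\<bar> \<le> (\<Prod>i<k. 1 / p + 1 / (1 - p))"
    unfolding abs_prod by (intro prod_mono conjI abs_ge_zero abs_overlap_le)
  then show ?thesis by simp
qed

lemma integral_overlap:
  assumes p: "0 < p" "p < 1" and z: "z \<in> space M" "z' \<in> space M"
  shows "(\<integral>x. overlap x z z' \<partial>M) = p / (1 - p) * (codegree M W z z' / p\<^sup>2) + (1 - p / (1 - p))"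
proof -
  have "integrable M (\<lambda>x. (1 - W x z) * (1 - W x z'))"
    unfolding left_diff_distrib right_diff_distrib using z by simp
  then have "(\<integral>x. overlap x z z' \<partial>M) =
      codegree M W z z' / p + (1 - 2 * p + codegree M W z z') / (1 - p)"
    unfolding overlap_def using z by (simp add: integral_one_minus_W_mult flip: codegree_def)
  also have "\<dots> = p / (1 - p) * (codegree M W z z' / p\<^sup>2) + (1 - p / (1 - p))"
    using p by (simp add: divide_simps power2_eq_square) (simp add: algebra_simps)
  finally show ?thesis .
qed

lemma chi_square_fin_nbhd_prob:
  assumes X [measurable]: "X \<in> space (power_measure M k)"
  shows "chi_square_fin (Pow {..<k}) (nbhd_prob M W k X) (random_subset_prob {..<k} (\<lambda>_. p)) =
    (\<integral>(z, z'). (\<Prod>i<k. overlap (X i) z z') \<partial>(M \<Otimes>\<^sub>M M)) - 1"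
proof -
  let ?w = "random_subset_prob {..<k} (\<lambda>_. p)" and ?v = "cond_nbhd_prob W k X"
  have int: "integrable (M \<Otimes>\<^sub>M M) (\<lambda>(z, z'). ?v z S * ?v z' S)" for S
    by (rule pair.integrable_bounded[where C = 1])
      (auto simp: abs_mult intro!: mult_le_one)
  have "(\<Sum>S\<in>Pow {..<k}. (nbhd_prob M W k X S)\<^sup>2 / ?w S) =
      (\<Sum>S\<in>Pow {..<k}. \<integral>zz. (case zz of (z, z') \<Rightarrow> ?v z S * ?v z' S) / ?w S \<partial>(M \<Otimes>\<^sub>M M))"
    by (simp add: nbhd_prob_def power2_eq_square pair.integral_pair_mult[OF int])
  also have "\<dots> = (\<integral>zz. (\<Sum>S\<in>Pow {..<k}. (case zz of (z, z') \<Rightarrow> ?v z S * ?v z' S) / ?w S) \<partial>(M \<Otimes>\<^sub>M M))"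
    using int by (intro Bochner_Integration.integral_sum[symmetric] integrable_divide)
  also have "\<dots> = (\<integral>(z, z'). (\<Prod>i<k. overlap (X i) z z') \<partial>(M \<Otimes>\<^sub>M M))"
    by (intro Bochner_Integration.integral_cong refl)
      (auto simp: cond_nbhd_prob_def overlap_def sum_random_subset_prob_mult_divide)
  finally show ?thesis by (simp add: chi_square_fin_def)
qed

lemma integral_prod_overlap:
  assumes p: "0 < p" "p < 1" and z [measurable]: "z \<in> space M" "z' \<in> space M"
  shows "(\<integral>X. (\<Prod>i<k. overlap (X i) z z') \<partial>power_measure M k) =
    (\<Sum>j\<le>k. Bernstein k j (p / (1 - p)) * (codegree M W z z' / p\<^sup>2) ^ j)"
proof -
  have "(\<integral>X. (\<Prod>i<k. overlap (X i) z z') \<partial>power_measure M k) = (\<Prod>i<k. \<integral>x. overlap x z z' \<partial>M)"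
    by (intro labels.product_integral_prod integrable_bounded[OF _ abs_overlap_le]) auto
  also have "\<dots> = (p / (1 - p) * (codegree M W z z' / p\<^sup>2) + (1 - p / (1 - p))) ^ k"
    using p z by (simp add: integral_overlap)
  finally show ?thesis
    by (simp only: binomial_ring Bernstein_def power_mult_distrib) (simp add: mult_ac)
qed

lemma integrable_codegree_power [simp]:
  "integrable (M \<Otimes>\<^sub>M M) (\<lambda>(z, z'). (codegree M W z z' / c) ^ j)"
proof (rule pair.integrable_bounded)
  fix zz assume "zz \<in> space (M \<Otimes>\<^sub>M M)"
  then have "(codegree M W (fst zz) (snd zz)) ^ j \<le> 1 ^ j"
    using p_bounds codegree_le[of "fst zz" "snd zz"]
    by (intro power_mono codegree_nonneg) (auto simp: space_pair_measure)
  then show "\<bar>case zz of (z, z') \<Rightarrow> (codegree M W z z' / c) ^ j\<bar> \<le> 1 / \<bar>c\<bar> ^ j"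
    using codegree_nonneg by (auto simp: split_def power_abs abs_divide power_divide divide_right_mono)
qed measurable

lemma nbhd_chi_square_eq:
  assumes p: "0 < p" "p < 1"
  shows "nbhd_chi_square M W p k =
    (\<Sum>j\<le>k. Bernstein k j (p / (1 - p)) * codegree_moment M W p j) - 1"
proof -
  let ?P = "power_measure M k" and ?MM = "M \<Otimes>\<^sub>M M"
  interpret PMM: pair_prob_space ?P ?MM ..
  have int: "integrable (?P \<Otimes>\<^sub>M ?MM) (\<lambda>(X, zz). \<Prod>i<k. overlap (X i) (fst zz) (snd zz))"
    by (rule PMM.integrable_bounded[where C = "(1 / p + 1 / (1 - p)) ^ k"])
      (measurable, simp add: split_def abs_prod_overlap_le del: abs_prod)
  have "nbhd_chi_square M W p k = (\<integral>X. (\<integral>(z, z'). (\<Prod>i<k. overlap (X i) z z') \<partial>?MM) - 1 \<partial>?P)"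
    unfolding nbhd_chi_square_def
    by (intro Bochner_Integration.integral_cong refl chi_square_fin_nbhd_prob)
  also have "\<dots> = (\<integral>X. (\<integral>zz. (\<Prod>i<k. overlap (X i) (fst zz) (snd zz)) \<partial>?MM) \<partial>?P) - 1"
    using PMM.integrable_fst[OF int] by (simp add: split_def power.prob_space)
  also have "(\<integral>X. (\<integral>zz. (\<Prod>i<k. overlap (X i) (fst zz) (snd zz)) \<partial>?MM) \<partial>?P) =
      (\<integral>zz. (\<integral>X. (\<Prod>i<k. overlap (X i) (fst zz) (snd zz)) \<partial>?P) \<partial>?MM)"
    by (rule PMM.Fubini_integral[OF int, symmetric])
  also have "\<dots> = (\<integral>zz. (\<Sum>j\<le>k. Bernstein k j (p / (1 - p)) *
      (case zz of (z, z') \<Rightarrow> (codegree M W z z' / p\<^sup>2) ^ j)) \<partial>?MM)"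
    using p by (intro Bochner_Integration.integral_cong refl)
      (auto simp: space_pair_measure integral_prod_overlap)
  also have "\<dots> = (\<Sum>j\<le>k. Bernstein k j (p / (1 - p)) * codegree_moment M W p j)"
    by (simp add: codegree_moment_def)
  finally show ?thesis .
qed

lemma tv_fin_graph_prob_le:
  assumes p: "0 < p" "p \<le> 1 / 2" and "0 \<le> c"
    and moment: "\<And>j. j < n \<Longrightarrow> codegree_moment M W p j \<le> 1 + c * (real j)\<^sup>2"
  defines "q \<equiv> p / (1 - p)"
  shows "tv_fin (graphs n) (graph_prob M W n) (gnp_prob n p) \<le>
    sqrt (real n * (c * (real n * q + (real n * q)\<^sup>2)))"
proof -
  let ?kl = "kl_fin (graphs n) (graph_prob M W n) (gnp_prob n p)"
  have p_less_1: "p < 1" using p by simp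
  have q: "0 \<le> q" "q \<le> 1" using p by (auto simp: q_def divide_le_eq)
  have step: "(\<Sum>j\<le>k. Bernstein k j q * codegree_moment M W p j) - 1 \<le>
      c * (real n * q + (real n * q)\<^sup>2)" if "k < n" for k
  proof -
    have "(\<Sum>j\<le>k. Bernstein k j q * codegree_moment M W p j) \<le> 1 + c * (real k * q + (real k * q)\<^sup>2)"
      using that q \<open>0 \<le> c\<close> by (intro sum_Bernstein_mult_le moment) auto
    also have "\<dots> \<le> 1 + c * (real n * q + (real n * q)\<^sup>2)"
      using that q \<open>0 \<le> c\<close>
      by (intro add_left_mono mult_left_mono add_mono power_mono mult_right_mono) auto
    finally show ?thesis by simp
  qed
  have "tv_fin (graphs n) (graph_prob M W n) (gnp_prob n p) \<le>
      sqrt (hellinger_sq (graphs n) (graph_prob M W n) (gnp_prob n p))"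
    using gnp_prob_pos[OF p(1) p_less_1]
    by (intro tv_fin_le_sqrt_hellinger_sq graph_prob_nonneg sum_graph_prob sum_gnp_prob less_imp_le)
  also have "\<dots> \<le> sqrt ?kl"
    using gnp_prob_pos[OF p(1) p_less_1]
    by (intro real_sqrt_le_mono hellinger_sq_le_kl_fin graph_prob_nonneg)
      (simp_all add: sum_graph_prob sum_gnp_prob)
  also have "?kl \<le> (\<Sum>k<n. (\<Sum>j\<le>k. Bernstein k j q * codegree_moment M W p j) - 1)"
    using kl_fin_graph_prob_le[OF p(1) p_less_1, of n]
    by (simp only: nbhd_chi_square_eq[OF p(1) p_less_1] q_def)
  also have "\<dots> \<le> real n * (c * (real n * q + (real n * q)\<^sup>2))"
    using sum_bounded_above[of "{..<n}", OF step] by simp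
  finally show ?thesis by simp
qed

end

section \<open>Moments of the codegree\<close>

lemma exp_le_quadratic:
  fixes x :: real
  assumes "\<bar>x\<bar> \<le> 1"
  shows "exp x \<le> 1 + x + x\<^sup>2"
proof (cases "0 \<le> x")
  case True
  then show ?thesis using exp_bound[of x] assms by simp
next
  case False
  have "1 \<le> 1 - x ^ 3" using False by (simp add: power_less_zero_eq less_imp_le)
  also have "\<dots> = (1 + x + x\<^sup>2) * (1 - x)" by (simp add: algebra_simps power2_eq_square power3_eq_cube)
  finally have "inverse (1 - x) \<le> 1 + x + x\<^sup>2"
    using False by (simp add: inverse_eq_divide pos_divide_le_eq)
  moreover have "exp x = inverse (exp (- x))" by (simp add: exp_minus)
  moreover have "inverse (exp (- x)) \<le> inverse (1 - x)"
    using False exp_ge_add_one_self[of "- x"] by (intro le_imp_inverse_le) auto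
  ultimately show ?thesis by linarith
qed

lemma one_plus_power_le_quadratic:
  fixes x :: real
  assumes "\<bar>real n * x\<bar> \<le> 1"
  shows "(1 + x) ^ n \<le> 1 + real n * x + (real n * x)\<^sup>2"
proof (cases "n = 0")
  case False
  then have "\<bar>x\<bar> \<le> real n * \<bar>x\<bar>" by (simp add: mult_le_cancel_right1)
  then have "0 \<le> 1 + x" using assms by (simp add: abs_mult)
  then have "(1 + x) ^ n \<le> exp x ^ n" by (intro power_mono) auto
  also have "\<dots> = exp (real n * x)" by (simp add: exp_of_nat_mult)
  also have "\<dots> \<le> 1 + real n * x + (real n * x)\<^sup>2" using assms by (rule exp_le_quadratic)
  finally show ?thesis .
qed simp

context regular_graphon
begin

lemma integrable_codegree [simp]: "integrable (M \<Otimes>\<^sub>M M) (\<lambda>(z, z'). codegree M W z z')"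
  using integrable_codegree_power[of 1 1] by simp

lemma integrable_codegree_diff_square [simp]:
  "integrable (M \<Otimes>\<^sub>M M) (\<lambda>(z, z'). (codegree M W z z' - a)\<^sup>2)"
proof -
  have "integrable (M \<Otimes>\<^sub>M M) (\<lambda>zz. (case zz of (z, z') \<Rightarrow> (codegree M W z z' / 1)\<^sup>2)
      - 2 * a * (case zz of (z, z') \<Rightarrow> codegree M W z z') + a\<^sup>2)"
    by (intro Bochner_Integration.integrable_add Bochner_Integration.integrable_diff
        integrable_codegree_power integrable_mult_right) auto
  then show ?thesis by (simp add: power2_diff split_def algebra_simps)
qed

lemma degree_right: "x \<in> space M \<Longrightarrow> (\<integral>y. W x y \<partial>M) = p"
  using degree by (simp add: W_sym[of x])

lemma integral_codegree: "(\<integral>(z, z'). codegree M W z z' \<partial>(M \<Otimes>\<^sub>M M)) = p\<^sup>2"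
proof -
  have inner: "(\<integral>z'. codegree M W z z' \<partial>M) = p\<^sup>2" if z [measurable]: "z \<in> space M" for z
  proof -
    have "integrable (M \<Otimes>\<^sub>M M) (\<lambda>(x, z'). W x z * W x z')"
      by (rule pair.integrable_bounded[where C = 1]) (auto simp: abs_mult intro!: mult_le_one)
    then have "(\<integral>z'. codegree M W z z' \<partial>M) = (\<integral>x. (\<integral>z'. W x z * W x z' \<partial>M) \<partial>M)"
      unfolding codegree_def by (rule pair.Fubini_integral)
    also have "\<dots> = (\<integral>x. W x z * p \<partial>M)"
      by (intro Bochner_Integration.integral_cong refl) (simp add: degree_right)
    also have "\<dots> = p\<^sup>2" using degree[OF z] by (simp add: power2_eq_square)
    finally show ?thesis .
  qed
  have "(\<integral>(z, z'). codegree M W z z' \<partial>(M \<Otimes>\<^sub>M M)) = (\<integral>z. (\<integral>z'. codegree M W z z' \<partial>M) \<partial>M)"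
    by (rule pair.integral_fst[symmetric]) simp
  also have "\<dots> = (\<integral>z. p\<^sup>2 \<partial>M)" by (intro Bochner_Integration.integral_cong refl inner)
  finally show ?thesis by (simp add: prob_space)
qed

text \<open>
  The probability \<open>N\<close> that a random vertex is joined to neither \<open>z\<close> nor \<open>z'\<close> is at most \<open>1 - p\<close> and
  has mean \<open>(1 - p)\<^sup>2\<close>, so \<open>N\<^sup>2 \<le> (1 - p) N\<close> bounds its second moment by \<open>(1 - p)\<^sup>3\<close>.
\<close>

lemma codegree_variance_le:
  "(\<integral>(z, z'). (codegree M W z z' - p\<^sup>2)\<^sup>2 \<partial>(M \<Otimes>\<^sub>M M)) \<le> (1 - p) ^ 3"
proof -
  let ?c = "\<lambda>zz. case zz of (z, z') \<Rightarrow> codegree M W z z'"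
  have pointwise: "(codegree M W z z' - p\<^sup>2)\<^sup>2 \<le>
      (1 - p) ^ 3 + (1 - p - 2 * (1 - p)\<^sup>2) * (codegree M W z z' - p\<^sup>2)"
    if z: "z \<in> space M" "z' \<in> space M" for z z'
  proof -
    define N u where "N = 1 - 2 * p + codegree M W z z'" and "u = 1 - p"
    have "0 \<le> N" "N \<le> u" using codegree_ge[OF z] codegree_le[OF z] by (auto simp: N_def u_def)
    then have "N\<^sup>2 \<le> u * N" by (simp add: power2_eq_square mult_right_mono)
    have "(N - u\<^sup>2)\<^sup>2 = N\<^sup>2 - 2 * u\<^sup>2 * N + u ^ 4" by (simp add: power2_diff)
    also have "\<dots> \<le> u * N - 2 * u\<^sup>2 * N + u ^ 4" using \<open>N\<^sup>2 \<le> u * N\<close> by simp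
    also have "\<dots> = u ^ 3 - u ^ 4 + (u - 2 * u\<^sup>2) * (N - u\<^sup>2)"
      by (simp add: algebra_simps eval_nat_numeral)
    also have "\<dots> \<le> u ^ 3 + (u - 2 * u\<^sup>2) * (N - u\<^sup>2)" by simp
    also have "N - u\<^sup>2 = codegree M W z z' - p\<^sup>2" by (simp add: N_def u_def power2_diff)
    finally show ?thesis unfolding u_def .
  qed
  have "(\<integral>(z, z'). (codegree M W z z' - p\<^sup>2)\<^sup>2 \<partial>(M \<Otimes>\<^sub>M M)) \<le>
      (\<integral>zz. (1 - p) ^ 3 + (1 - p - 2 * (1 - p)\<^sup>2) * (?c zz - p\<^sup>2) \<partial>(M \<Otimes>\<^sub>M M))"
    by (intro integral_mono) (auto simp: space_pair_measure pointwise)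
  also have "\<dots> = (1 - p) ^ 3" by (simp add: integral_codegree pair.prob_space)
  finally show ?thesis .
qed

lemma abs_codegree_diff_le:
  assumes z: "z \<in> space M" "z' \<in> space M"
  shows "\<bar>codegree M W z z' - p\<^sup>2\<bar> \<le> 1 - p"
proof -
  have "codegree M W z z' - p\<^sup>2 \<le> p * (1 - p)"
    using codegree_le[OF z] by (simp add: power2_eq_square right_diff_distrib)
  moreover have "p * (1 - p) \<le> 1 - p" using p_bounds by (intro mult_left_le_one_le) auto
  moreover have "- (1 - p)\<^sup>2 \<le> codegree M W z z' - p\<^sup>2"
    using codegree_ge[OF z] by (simp add: power2_diff)
  moreover have "(1 - p)\<^sup>2 \<le> 1 - p"
    unfolding power2_eq_square using p_bounds by (intro mult_left_le_one_le) auto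
  ultimately show ?thesis by linarith
qed

lemma codegree_power_le:
  assumes p: "1 / 2 \<le> p" and j: "4 * real j * (1 - p) \<le> 1"
    and z: "z \<in> space M" "z' \<in> space M"
  shows "(codegree M W z z' / p\<^sup>2) ^ j \<le>
    1 + real j / p\<^sup>2 * (codegree M W z z' - p\<^sup>2) + 16 * (real j)\<^sup>2 * (codegree M W z z' - p\<^sup>2)\<^sup>2"
proof -
  have p_pos: "0 < p" using p by simp
  have "(1 / 2)\<^sup>2 \<le> p\<^sup>2" using p by (intro power_mono) auto
  then have inv_p: "1 / p\<^sup>2 \<le> 4" using p_pos by (simp add: field_simps power2_eq_square)
  define D where "D = codegree M W z z' - p\<^sup>2"
  have "real j * (1 / p\<^sup>2) * \<bar>D\<bar> \<le> real j * 4 * (1 - p)"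
    using inv_p abs_codegree_diff_le[OF z] p_bounds unfolding D_def
    by (intro mult_mono mult_left_mono) auto
  then have "\<bar>real j * (D / p\<^sup>2)\<bar> \<le> 1" using j by (simp add: abs_mult)
  then have "(1 + D / p\<^sup>2) ^ j \<le> 1 + real j * (D / p\<^sup>2) + (real j * (D / p\<^sup>2))\<^sup>2"
    by (rule one_plus_power_le_quadratic)
  also have "(real j * (D / p\<^sup>2))\<^sup>2 = (1 / p\<^sup>2)\<^sup>2 * ((real j)\<^sup>2 * D\<^sup>2)"
    by (simp add: power_mult_distrib power_divide)
  also have "\<dots> \<le> 4\<^sup>2 * ((real j)\<^sup>2 * D\<^sup>2)"
    using inv_p by (intro mult_right_mono power_mono) auto
  also have "1 + D / p\<^sup>2 = codegree M W z z' / p\<^sup>2" using p_pos by (simp add: D_def field_simps)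
  finally show ?thesis by (simp add: D_def)
qed

lemma codegree_moment_le:
  assumes p: "1 / 2 \<le> p" and j: "4 * real j * (1 - p) \<le> 1"
  shows "codegree_moment M W p j \<le> 1 + 16 * (real j)\<^sup>2 * (1 - p) ^ 3"
proof -
  let ?D = "\<lambda>zz. case zz of (z, z') \<Rightarrow> codegree M W z z' - p\<^sup>2"
  let ?D2 = "\<lambda>zz. case zz of (z, z') \<Rightarrow> (codegree M W z z' - p\<^sup>2)\<^sup>2"
  have int_D: "integrable (M \<Otimes>\<^sub>M M) ?D"
    using integrable_codegree by (simp add: split_def)
  have "codegree_moment M W p j \<le>
      (\<integral>zz. 1 + real j / p\<^sup>2 * ?D zz + 16 * (real j)\<^sup>2 * ?D2 zz \<partial>(M \<Otimes>\<^sub>M M))"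
    unfolding codegree_moment_def using int_D
    by (intro integral_mono) (use codegree_power_le[OF p j] in \<open>auto simp: space_pair_measure\<close>)
  also have "\<dots> = 1 + real j / p\<^sup>2 * (\<integral>zz. ?D zz \<partial>(M \<Otimes>\<^sub>M M))
      + 16 * (real j)\<^sup>2 * (\<integral>zz. ?D2 zz \<partial>(M \<Otimes>\<^sub>M M))"
    using int_D by (simp add: pair.prob_space)
  also have "(\<integral>zz. ?D zz \<partial>(M \<Otimes>\<^sub>M M)) = 0"
    using integral_codegree integrable_codegree by (simp add: split_def pair.prob_space)
  also have "16 * (real j)\<^sup>2 * (\<integral>zz. ?D2 zz \<partial>(M \<Otimes>\<^sub>M M)) \<le> 16 * (real j)\<^sup>2 * (1 - p) ^ 3"
    by (intro mult_left_mono codegree_variance_le) auto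
  finally show ?thesis by simp
qed

lemma codegree_moment_eq_iterated:
  "codegree_moment M W p j = (\<integral>z. (\<integral>z'. (codegree M W z z' / p\<^sup>2) ^ j \<partial>M) \<partial>M)"
  unfolding codegree_moment_def by (rule pair.integral_fst[symmetric]) simp

end

definition tensor_power :: "nat \<Rightarrow> ('a \<Rightarrow> 'a \<Rightarrow> real) \<Rightarrow> (nat \<Rightarrow> 'a) \<Rightarrow> (nat \<Rightarrow> 'a) \<Rightarrow> real" where
  "tensor_power d W x y = (\<Prod>i<d. W (x i) (y i))"

context regular_graphon
begin

lemma regular_graphon_tensor_power:
  "regular_graphon (power_measure M d) (tensor_power d W) (p ^ d)"
  unfolding tensor_power_def[abs_def]
proof unfold_locales
  fix z assume "z \<in> space (power_measure M d)"
  then have z: "z i \<in> space M" if "i < d" for i using that by (auto simp: space_PiM)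
  have "(\<integral>x. (\<Prod>i<d. W (x i) (z i)) \<partial>power_measure M d) = (\<Prod>i<d. \<integral>x. W x (z i) \<partial>M)"
    using z by (intro labels.product_integral_prod) auto
  then show "(\<integral>x. (\<Prod>i<d. W (x i) (z i)) \<partial>power_measure M d) = p ^ d"
    using z by (simp add: degree)
qed (auto intro: prod_nonneg prod_le_1 simp: W_sym)

lemma codegree_tensor_power:
  assumes "z \<in> space (power_measure M d)" "z' \<in> space (power_measure M d)"
  shows "codegree (power_measure M d) (tensor_power d W) z z' = (\<Prod>i<d. codegree M W (z i) (z' i))"
proof -
  have z: "z i \<in> space M" "z' i \<in> space M" if "i < d" for i using that assms by (auto simp: space_PiM)
  show ?thesis
    unfolding codegree_def tensor_power_def prod.distrib[symmetric]
    using z by (intro labels.product_integral_prod) auto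
qed

lemma codegree_moment_tensor_power:
  "codegree_moment (power_measure M d) (tensor_power d W) (p ^ d) j = codegree_moment M W p j ^ d"
proof -
  interpret T: regular_graphon "power_measure M d" "tensor_power d W" "p ^ d"
    by (rule regular_graphon_tensor_power)
  let ?y = "\<lambda>a b. (codegree M W a b / p\<^sup>2) ^ j"
  have int: "integrable M (?y a)" if [measurable]: "a \<in> space M" for a
  proof (rule integrable_bounded)
    show "\<bar>?y a b\<bar> \<le> (1 / p\<^sup>2) ^ j" if b: "b \<in> space M" for b
      using codegree_nonneg[of a b] codegree_le[OF \<open>a \<in> space M\<close> b] p_bounds
      by (simp add: power_abs abs_divide) (intro power_mono divide_right_mono, auto)
  qed measurable
  have "codegree_moment (power_measure M d) (tensor_power d W) (p ^ d) j =
      (\<integral>z. (\<integral>z'. (\<Prod>i<d. ?y (z i) (z' i)) \<partial>power_measure M d) \<partial>power_measure M d)"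
    unfolding T.codegree_moment_eq_iterated
    by (intro Bochner_Integration.integral_cong refl)
      (simp add: codegree_tensor_power prod_dividef prod_power_distrib power_divide
        power_mult[symmetric] mult_ac)
  also have "\<dots> = (\<integral>z. (\<Prod>i<d. \<integral>b. ?y (z i) b \<partial>M) \<partial>power_measure M d)"
    by (intro Bochner_Integration.integral_cong refl labels.product_integral_prod int)
      (auto simp: space_PiM)
  also have "\<dots> = (\<Prod>i<d. \<integral>a. (\<integral>b. ?y a b \<partial>M) \<partial>M)"
    using pair.integrable_fst[OF integrable_codegree_power] by (intro labels.product_integral_prod) auto
  finally show ?thesis by (simp add: codegree_moment_eq_iterated)
qed

lemma codegree_moment_tensor_power_le:
  assumes p: "1 / 2 \<le> p" and j: "4 * real j * (1 - p) \<le> 1" "16 * (real j)\<^sup>2 * real d * (1 - p) ^ 3 \<le> 1"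
  shows "codegree_moment (power_measure M d) (tensor_power d W) (p ^ d) j \<le>
    1 + 32 * real d * (1 - p) ^ 3 * (real j)\<^sup>2"
proof -
  define x where "x = 16 * (real j)\<^sup>2 * (1 - p) ^ 3"
  have x: "0 \<le> real d * x" "real d * x \<le> 1" using p_bounds j(2) by (auto simp: x_def mult_ac)
  have "0 \<le> codegree_moment M W p j"
    unfolding codegree_moment_def using codegree_nonneg
    by (intro Bochner_Integration.integral_nonneg) auto
  then have "codegree_moment M W p j ^ d \<le> (1 + x) ^ d"
    using codegree_moment_le[OF p j(1)] by (intro power_mono) (auto simp: x_def)
  also have "\<dots> \<le> 1 + real d * x + (real d * x)\<^sup>2"
    using x by (intro one_plus_power_le_quadratic) auto
  also have "(real d * x)\<^sup>2 \<le> real d * x"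
    using x by (simp add: power2_eq_square mult_left_le)
  finally show ?thesis by (simp add: codegree_moment_tensor_power x_def mult_ac)
qed

lemma tv_fin_graph_prob_tensor_power_le:
  assumes p: "1 / 2 \<le> p" "p ^ d \<le> 1 / 2"
    and n: "4 * real n * (1 - p) \<le> 1" "16 * (real n)\<^sup>2 * real d * (1 - p) ^ 3 \<le> 1"
  defines "q \<equiv> p ^ d / (1 - p ^ d)"
  shows "tv_fin (graphs n) (graph_prob (power_measure M d) (tensor_power d W) n) (gnp_prob n (p ^ d)) \<le>
    sqrt (real n * (32 * real d * (1 - p) ^ 3 * (real n * q + (real n * q)\<^sup>2)))"
proof -
  interpret T: regular_graphon "power_measure M d" "tensor_power d W" "p ^ d"
    by (rule regular_graphon_tensor_power)
  show ?thesis
    unfolding q_def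
  proof (intro T.tv_fin_graph_prob_le codegree_moment_tensor_power_le p)
    fix j assume "j < n"
    then have "4 * real j * (1 - p) \<le> 4 * real n * (1 - p)"
      "16 * (real j)\<^sup>2 * real d * (1 - p) ^ 3 \<le> 16 * (real n)\<^sup>2 * real d * (1 - p) ^ 3"
      using p_bounds by (auto intro!: mult_right_mono power_mono)
    then show "4 * real j * (1 - p) \<le> 1" "16 * (real j)\<^sup>2 * real d * (1 - p) ^ 3 \<le> 1"
      using n by auto
  qed (use p p_bounds in auto)
qed

lemma integral_W: "(\<integral>(x, y). W x y \<partial>(M \<Otimes>\<^sub>M M)) = p"
proof -
  have "integrable (M \<Otimes>\<^sub>M M) (\<lambda>(x, y). W x y)"
    by (rule pair.integrable_bounded[where C = 1]) (auto simp: W_pair_measurable)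
  then have "(\<integral>(x, y). W x y \<partial>(M \<Otimes>\<^sub>M M)) = (\<integral>y. (\<integral>x. W x y \<partial>M) \<partial>M)"
    by (rule pair.integral_snd[symmetric])
  also have "\<dots> = (\<integral>y. p \<partial>M)" by (intro Bochner_Integration.integral_cong refl degree)
  finally show ?thesis by (simp add: prob_space)
qed

end

section \<open>The circle and the torus\<close>

lemma emeasure_lborel_translate:
  fixes B :: "'a :: euclidean_space set"
  assumes "B \<in> sets borel"
  shows "emeasure lborel ((+) a -` B) = emeasure lborel B"
proof -
  have "emeasure lborel ((+) a -` B) = emeasure (distr lborel borel ((+) a)) B"
    using assms by (simp add: emeasure_distr)
  then show ?thesis by (simp add: lborel_distr_plus)
qed

lemma periodic_add_of_int_mult:
  fixes T :: "'a :: comm_ring_1"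
  assumes "\<And>x. P (x + T) \<longleftrightarrow> P x"
  shows "P (x + of_int k * T) \<longleftrightarrow> P x"
proof (induction k rule: int_induct[where k = 0])
  case (step1 i)
  then show ?case using assms[of "x + of_int i * T"] by (simp add: algebra_simps)
next
  case (step2 i)
  then show ?case using assms[of "x + of_int (i - 1) * T"] by (simp add: algebra_simps)
qed simp

lemma emeasure_lborel_periodic:
  fixes A :: "real set"
  assumes A [measurable]: "A \<in> sets borel" and "0 < T" and periodic: "\<And>x. x + T \<in> A \<longleftrightarrow> x \<in> A"
  shows "emeasure lborel (A \<inter> {c..<c + T}) = emeasure lborel (A \<inter> {0..<T})"
proof -
  define m where "m = \<lfloor>c / T\<rfloor>"
  define a where "a = c - of_int m * T"
  have "of_int m \<le> c / T" "c / T < of_int m + 1" unfolding m_def by linarith+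
  then have a: "0 \<le> a" "a < T" using \<open>0 < T\<close> by (auto simp: a_def field_simps)
  have shift: "emeasure lborel (A \<inter> {l + of_int k * T..<r + of_int k * T}) =
      emeasure lborel (A \<inter> {l..<r})" for l r and k :: int
  proof -
    have "(+) (of_int k * T) -` (A \<inter> {l + of_int k * T..<r + of_int k * T}) = A \<inter> {l..<r}"
      using periodic_add_of_int_mult[of "\<lambda>x. x \<in> A" T, OF periodic] by (auto simp: add.commute)
    then show ?thesis
      using emeasure_lborel_translate[of "A \<inter> {l + of_int k * T..<r + of_int k * T}" "of_int k * T"]
      by simp
  qed
  have "A \<inter> {c..<c + T} = (A \<inter> {a + of_int m * T..<T + of_int m * T}) \<union>
      (A \<inter> {0 + of_int (m + 1) * T..<a + of_int (m + 1) * T})"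
    using a by (auto simp: a_def algebra_simps)
  then have "emeasure lborel (A \<inter> {c..<c + T}) =
      emeasure lborel (A \<inter> {a + of_int m * T..<T + of_int m * T}) +
      emeasure lborel (A \<inter> {0 + of_int (m + 1) * T..<a + of_int (m + 1) * T})"
    by (simp, intro plus_emeasure[symmetric]) (auto simp: algebra_simps)
  also have "\<dots> = emeasure lborel (A \<inter> {a..<T}) + emeasure lborel (A \<inter> {0..<a})"
    unfolding shift ..
  also have "\<dots> = emeasure lborel ((A \<inter> {a..<T}) \<union> (A \<inter> {0..<a}))"
    by (intro plus_emeasure) auto
  also have "(A \<inter> {a..<T}) \<union> (A \<inter> {0..<a}) = A \<inter> {0..<T}" using a by auto
  finally show ?thesis .
qed

lemma circ_dist_measurable: "case_prod circ_dist \<in> borel_measurable (borel \<Otimes>\<^sub>M borel)"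
  unfolding circ_dist_def frac_def Let_def split_def by measurable

lemma circ_dist_sym: "circ_dist x y = circ_dist y x"
proof -
  have neg: "(y - x) / 2 = - ((x - y) / 2)" by (simp add: field_simps)
  show ?thesis
    unfolding circ_dist_def Let_def neg frac_neg by (auto simp: min_def frac_eq_0_iff[THEN iffD2])
qed

lemma circ_dist_add_2: "circ_dist (x + 2) b = circ_dist x b"
proof -
  have "(x + 2 - b) / 2 = (x - b) / 2 + 1" by simp
  then show ?thesis by (simp only: circ_dist_def frac_1_eq)
qed

lemma circ_dist_eq_abs_diff:
  assumes "\<bar>x - b\<bar> \<le> 1"
  shows "circ_dist x b = \<bar>x - b\<bar>"
proof (cases "b \<le> x")
  case True
  then have "frac ((x - b) / 2) = (x - b) / 2" using assms by (simp add: frac_eq)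
  then show ?thesis using True assms by (simp add: circ_dist_def Let_def min_def field_simps)
next
  case False
  then have "frac ((x - b) / 2) = (x - b) / 2 + 1"
    using assms unfolding frac_unique_iff by (simp add: field_simps)
  then show ?thesis using False assms by (simp add: circ_dist_def Let_def min_def field_simps)
qed

abbreviation circle_unif :: "real measure" where
  "circle_unif \<equiv> uniform_measure lborel {0..<2}"

lemma measure_circ_dist_le:
  assumes t: "0 \<le> t" "t \<le> 1"
  shows "measure circle_unif {x. circ_dist x b \<le> t} = t"
proof -
  let ?A = "{x. circ_dist x b \<le> t}"
  have [measurable]: "(\<lambda>x. circ_dist x b) \<in> borel_measurable borel"
    using measurable_compose[OF _ circ_dist_measurable, of "\<lambda>x. (x, b)" borel] by simp
  have A: "?A \<in> sets borel" by measurable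
  have "emeasure lborel (?A \<inter> {0..<2}) = emeasure lborel (?A \<inter> {b - 1..<b - 1 + 2})"
    using emeasure_lborel_periodic[OF A, of 2 "b - 1"] by (simp add: circ_dist_add_2)
  also have "?A \<inter> {b - 1..<b - 1 + 2} = {b - t..b + t} \<inter> {b - 1..<b - 1 + 2}"
    by (auto simp: circ_dist_eq_abs_diff abs_le_iff)
  also have "\<dots> = (if t = 1 then {b - 1..<b - 1 + 2} else {b - t..b + t})" using t by auto
  also have "emeasure lborel \<dots> = ennreal (2 * t)" using t by auto
  finally show ?thesis
    using A t divide_ennreal[of "2 * t" 2] by (simp add: measure_def Int_commute)
qed

definition circ_kernel :: "real \<Rightarrow> real \<Rightarrow> real \<Rightarrow> real" where
  "circ_kernel t x y = of_bool (circ_dist x y \<le> t)"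

lemma regular_graphon_circ_kernel:
  assumes t: "0 \<le> t" "t \<le> 1"
  shows "regular_graphon circle_unif (circ_kernel t) t"
proof -
  interpret prob_space circle_unif by (rule prob_space_uniform_measure) auto
  have [measurable]: "case_prod circ_dist \<in> borel_measurable (circle_unif \<Otimes>\<^sub>M circle_unif)"
    using circ_dist_measurable by (simp cong: measurable_cong_sets sets_pair_measure_cong)
  show ?thesis
  proof unfold_locales
    show "case_prod (circ_kernel t) \<in> borel_measurable (circle_unif \<Otimes>\<^sub>M circle_unif)"
      unfolding circ_kernel_def split_def by measurable
    fix z :: real
    have "(\<integral>x. circ_kernel t x z \<partial>circle_unif) = (\<integral>x. indicator {x. circ_dist x z \<le> t} x \<partial>circle_unif)"
      by (intro Bochner_Integration.integral_cong) (auto simp: circ_kernel_def)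
    also have "\<dots> = t" by (simp add: measure_circ_dist_le[OF t])
    finally show "(\<integral>x. circ_kernel t x z \<partial>circle_unif) = t" .
  qed (auto simp: circ_kernel_def circ_dist_sym)
qed

lemma regular_graphon_torus:
  assumes "0 \<le> t" "t \<le> 1"
  shows "regular_graphon (torus_unif d) (tensor_power d (circ_kernel t)) (t ^ d)"
  unfolding torus_unif_def using assms
  by (intro regular_graphon.regular_graphon_tensor_power regular_graphon_circ_kernel)

lemma linf_dist_le_iff: "0 \<le> t \<Longrightarrow> linf_dist d x y \<le> t \<longleftrightarrow> (\<forall>i<d. circ_dist (x i) (y i) \<le> t)"
  unfolding linf_dist_def by (subst Max_le_iff) auto

lemma tensor_power_circ_kernel:
  "0 \<le> t \<Longrightarrow> tensor_power d (circ_kernel t) x y = of_bool (linf_dist d x y \<le> t)"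
  by (auto simp: tensor_power_def circ_kernel_def linf_dist_le_iff intro!: prod.neutral)

lemma measure_linf_dist_le:
  assumes t: "0 \<le> t" "t \<le> 1"
  shows "measure (torus_unif d \<Otimes>\<^sub>M torus_unif d)
    {xy \<in> space (torus_unif d \<Otimes>\<^sub>M torus_unif d). linf_dist d (fst xy) (snd xy) \<le> t} = t ^ d"
proof -
  interpret T: regular_graphon "torus_unif d" "tensor_power d (circ_kernel t)" "t ^ d"
    using t by (rule regular_graphon_torus)
  let ?TT = "torus_unif d \<Otimes>\<^sub>M torus_unif d"
  have "measure ?TT {xy \<in> space ?TT. linf_dist d (fst xy) (snd xy) \<le> t} =
      (\<integral>xy. indicator {xy \<in> space ?TT. linf_dist d (fst xy) (snd xy) \<le> t} xy \<partial>?TT)"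
    by (simp add: Int_absorb2 subset_eq)
  also have "\<dots> = (\<integral>(x, y). tensor_power d (circ_kernel t) x y \<partial>?TT)"
    by (intro Bochner_Integration.integral_cong refl)
      (auto simp: tensor_power_circ_kernel[OF t(1)] indicator_def)
  finally show ?thesis by (simp only: T.integral_W)
qed

lemma tau_inf_eq_root:
  assumes d: "0 < d" and p: "0 \<le> p" "p \<le> 1"
  shows "tau_inf d p = root d p"
  unfolding tau_inf_def
proof (rule the_equality)
  show "0 \<le> root d p \<and> root d p \<le> 1 \<and> measure (torus_unif d \<Otimes>\<^sub>M torus_unif d)
      {xy \<in> space (torus_unif d \<Otimes>\<^sub>M torus_unif d). linf_dist d (fst xy) (snd xy) \<le> root d p} = p"
    using d p by (simp add: measure_linf_dist_le)
  fix t assume "0 \<le> t \<and> t \<le> 1 \<and> measure (torus_unif d \<Otimes>\<^sub>M torus_unif d)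
      {xy \<in> space (torus_unif d \<Otimes>\<^sub>M torus_unif d). linf_dist d (fst xy) (snd xy) \<le> t} = p"
  then have "0 \<le> t" "t ^ d = p" by (auto simp: measure_linf_dist_le)
  then show "t = root d p" using d by (simp add: real_root_power_cancel flip: \<open>t ^ d = p\<close>)
qed

lemma rgg_prob_eq_graph_prob:
  assumes d: "0 < d" and p: "0 \<le> p" "p \<le> 1" and E: "E \<in> graphs n"
  shows "rgg_prob n d p E = graph_prob (torus_unif d) (tensor_power d (circ_kernel (root d p))) n E"
proof -
  define t where "t = root d p"
  have t: "0 \<le> t" using d p by (simp add: t_def)
  let ?A = "{X \<in> space (latent_points n d). rgg_graph n d t X = E}"
  have "rgg_graph n d t X = {e \<in> all_pairs n. linf_dist d (X (fst e)) (X (snd e)) \<le> t}" for X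
    by (auto simp: rgg_graph_def)
  then have cond: "cond_graph_prob (tensor_power d (circ_kernel t)) n X E =
      of_bool (rgg_graph n d t X = E)" for X
    using E by (simp add: cond_graph_prob_def split_def tensor_power_circ_kernel[OF t]
        random_subset_prob_of_bool graphs_def)
  have "rgg_prob n d p E = (\<integral>X. indicator ?A X \<partial>latent_points n d)"
    using d p by (simp add: rgg_prob_def tau_inf_eq_root t_def Int_absorb2 subset_eq)
  also have "\<dots> = graph_prob (torus_unif d) (tensor_power d (circ_kernel t)) n E"
    unfolding graph_prob_def latent_points_def
    by (intro Bochner_Integration.integral_cong refl) (simp add: cond indicator_def)
  finally show ?thesis unfolding t_def .
qed

section \<open>Convergence to the Erdos-Renyi graph\<close>

lemma one_minus_root_le:
  assumes "0 < d" "0 < p"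
  shows "1 - root d p \<le> - ln p / real d"
proof -
  have "1 + ln p / real d \<le> exp (ln p / real d)" by (rule exp_ge_add_one_self)
  also have "\<dots> = exp (ln (root d p))" using assms by (simp add: ln_root)
  finally show ?thesis using assms by simp
qed

lemma one_minus_root_cube_le:
  assumes "0 < d" "0 < p" "p \<le> 1" and L: "- ln p \<le> L"
  shows "real d * (1 - root d p) ^ 3 \<le> (L powr (3/2) / real d)\<^sup>2"
proof -
  have "0 \<le> 1 - root d p" using assms by simp
  moreover have "1 - root d p \<le> L / real d"
    using one_minus_root_le[of d p] divide_right_mono[OF L, of "real d"] assms by simp
  ultimately have "real d * (1 - root d p) ^ 3 \<le> real d * (L / real d) ^ 3"
    by (intro mult_left_mono power_mono) auto
  also have "\<dots> = L ^ 3 / (real d)\<^sup>2"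
    using \<open>0 < d\<close> by (simp add: power_divide power2_eq_square power3_eq_cube)
  also have "L ^ 3 = (L powr (3/2))\<^sup>2"
  proof -
    have "0 \<le> L" using ln_le_zero_iff[of p] assms by linarith
    then show ?thesis by (cases "L = 0") (simp_all add: power2_eq_square flip: powr_add)
  qed
  finally show ?thesis by (simp add: power_divide)
qed

lemma odds_plus_square_le:
  fixes p x :: real
  assumes p: "0 < p" "p \<le> 1 / 2" and x: "1 \<le> x * p"
  shows "x * (p / (1 - p)) + (x * (p / (1 - p)))\<^sup>2 \<le> 6 * (x * p)\<^sup>2"
proof -
  have "p * (2 * p) \<le> p * 1" using p by (intro mult_left_mono) auto
  then have odds: "0 \<le> p / (1 - p)" "p / (1 - p) \<le> 2 * p"
    using p by (auto simp: divide_le_eq algebra_simps)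
  have "0 < x * p" using x by linarith
  then have "0 < x" using p by (simp add: zero_less_mult_iff)
  then have x_odds: "0 \<le> x * (p / (1 - p))" "x * (p / (1 - p)) \<le> 2 * (x * p)"
    using mult_left_mono[OF odds(1), of x] mult_left_mono[OF odds(2), of x] by simp_all
  then have "(x * (p / (1 - p)))\<^sup>2 \<le> (2 * (x * p))\<^sup>2" by (intro power_mono)
  moreover have "1 * (x * p) \<le> (x * p) * (x * p)" using x by (intro mult_right_mono) auto
  ultimately show ?thesis using x_odds by (simp add: power2_eq_square)
qed

lemma tv_rgg_gnp_le_root:
  assumes d: "0 < d" and np: "1 \<le> real n * p" and p: "p \<le> 1 / 2"
    and u_eq: "u = 1 - root d p" and n: "4 * real n * u \<le> 1" "16 * (real n)\<^sup>2 * real d * u ^ 3 \<le> 1"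
  shows "tv_rgg_gnp n d p \<le> 14 * sqrt (real n ^ 3 * p\<^sup>2 * (real d * u ^ 3))"
proof -
  define t where "t = root d p"
  have "0 < real n * p" using np by linarith
  then have p_pos: "0 < p" and n_ge_1: "1 \<le> n" by (auto simp: zero_less_mult_iff)
  have t: "0 \<le> t" "t \<le> 1" "t ^ d = p" using d p_pos p by (auto simp: t_def)
  have u: "0 \<le> u" "1 - t = u" using t by (auto simp: u_eq t_def)
  have "1 * u \<le> real n * u" using n_ge_1 u by (intro mult_right_mono) auto
  then have t_half: "1 / 2 \<le> t" using n(1) u by linarith
  define q where "q = p / (1 - p)"
  have "real n * q + (real n * q)\<^sup>2 \<le> 6 * (real n * p)\<^sup>2"
    unfolding q_def using p_pos p np by (rule odds_plus_square_le)
  then have "real n * (32 * real d * u ^ 3 * (real n * q + (real n * q)\<^sup>2)) \<le>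
      real n * (32 * real d * u ^ 3 * (6 * (real n * p)\<^sup>2))"
    using u by (intro mult_left_mono) auto
  also have "\<dots> = 192 * (real n ^ 3 * p\<^sup>2 * (real d * u ^ 3))"
    by (simp add: power2_eq_square power3_eq_cube)
  also have "\<dots> \<le> 14\<^sup>2 * (real n ^ 3 * p\<^sup>2 * (real d * u ^ 3))"
    using u by (intro mult_right_mono) auto
  finally have bound: "real n * (32 * real d * u ^ 3 * (real n * q + (real n * q)\<^sup>2)) \<le>
      14\<^sup>2 * (real n ^ 3 * p\<^sup>2 * (real d * u ^ 3))" .
  interpret regular_graphon circle_unif "circ_kernel t" t
    using t by (intro regular_graphon_circ_kernel)
  have "tv_rgg_gnp n d p =
      tv_fin (graphs n) (graph_prob (torus_unif d) (tensor_power d (circ_kernel t)) n) (gnp_prob n (t ^ d))"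
    unfolding tv_rgg_gnp_def tv_fin_def t(3) t_def
    using p p_pos d by (simp add: rgg_prob_eq_graph_prob cong: sum.cong)
  also have "\<dots> \<le> sqrt (real n * (32 * real d * u ^ 3 * (real n * q + (real n * q)\<^sup>2)))"
    unfolding torus_unif_def q_def
    using tv_fin_graph_prob_tensor_power_le[of d n] n t_half t p u by simp
  also have "\<dots> \<le> sqrt (14\<^sup>2 * (real n ^ 3 * p\<^sup>2 * (real d * u ^ 3)))"
    using bound by (rule real_sqrt_le_mono)
  finally show ?thesis by (simp add: real_sqrt_mult)
qed

lemma tv_rgg_gnp_le:
  assumes n: "3 \<le> n" and p: "1 / real n \<le> p" "p \<le> 1 / 2"
    and d: "4 * (real n * ln (real n) powr (3/2)) \<le> real d"
  shows "tv_rgg_gnp n d p \<le> 14 * (real n powr (3/2) * p * ln (real n) powr (3/2) / real d)"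
proof -
  define L K where "L = ln (real n)" and "K = L powr (3/2)"
  have "exp 1 \<le> real n" using exp_le n by linarith
  then have L: "1 \<le> L" using n by (simp add: L_def ln_ge_iff)
  then have K: "L \<le> K" unfolding K_def using powr_mono[of 1 "3/2" L] by simp
  have four_nK_le: "4 * (real n * K) \<le> real d" using d by (simp add: K_def L_def)
  moreover have "0 < 4 * (real n * K)" using n L K by simp
  ultimately have d_pos: "0 < real d" by linarith
  have p_pos: "0 < p" using less_le_trans[OF _ p(1), of 0] n by simp
  have ln_p: "- ln p \<le> L"
    using ln_le_cancel_iff[of "1 / real n" p] p p_pos n by (simp add: L_def ln_div)
  define u where "u = 1 - root d p"
  have cube_le: "real d * u ^ 3 \<le> (K / real d)\<^sup>2"
    unfolding u_def K_def using d_pos p_pos p ln_p by (intro one_minus_root_cube_le) auto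
  have "u \<le> - ln p / real d" unfolding u_def using d_pos p_pos by (intro one_minus_root_le) auto
  also have "\<dots> \<le> K / real d" using ln_p K d_pos by (intro divide_right_mono) auto
  finally have "4 * real n * u \<le> 4 * real n * (K / real d)" by (intro mult_left_mono) auto
  moreover have ratio: "4 * real n * (K / real d) \<le> 1" using four_nK_le d_pos by (simp add: field_simps)
  ultimately have "4 * real n * u \<le> 1" by linarith
  moreover have "16 * (real n)\<^sup>2 * real d * u ^ 3 \<le> 1"
  proof -
    have "16 * (real n)\<^sup>2 * (real d * u ^ 3) \<le> 16 * (real n)\<^sup>2 * (K / real d)\<^sup>2"
      using cube_le by (intro mult_left_mono) auto
    also have "\<dots> = (4 * real n * (K / real d))\<^sup>2" by (simp add: power_mult_distrib power_divide)
    also have "\<dots> \<le> 1" using ratio L K d_pos by (intro power_le_one) auto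
    finally show ?thesis by (simp add: mult.assoc)
  qed
  ultimately have "tv_rgg_gnp n d p \<le> 14 * sqrt (real n ^ 3 * p\<^sup>2 * (real d * u ^ 3))"
    using d_pos n p by (intro tv_rgg_gnp_le_root) (auto simp: u_def field_simps)
  also have "\<dots> \<le> 14 * sqrt (real n ^ 3 * p\<^sup>2 * (K / real d)\<^sup>2)"
    using cube_le by (intro mult_left_mono real_sqrt_le_mono) auto
  also have "real n ^ 3 * p\<^sup>2 * (K / real d)\<^sup>2 = (real n powr (3/2) * p * K / real d)\<^sup>2"
  proof -
    have "real n ^ 3 = (real n powr (3/2))\<^sup>2"
      using n by (simp add: power2_eq_square flip: powr_add)
    then show ?thesis by (simp add: power_mult_distrib power_divide)
  qed
  finally show ?thesis using p_pos L K d_pos by (simp add: K_def L_def)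
qed

lemma tv_rgg_gnp_le_inverse_ratio:
  assumes n: "3 \<le> n" and p: "1 / real n \<le> p" "p \<le> 1 / 2" and "4 \<le> R"
    and R: "R = real d / (max (real n powr (3/2) * p) (real n) * ln (real n) powr (3/2))"
  shows "tv_rgg_gnp n d p \<le> 14 / R"
proof -
  define m K where "m = max (real n powr (3/2) * p) (real n)" and "K = ln (real n) powr (3/2)"
  have R_eq: "R = real d / (m * K)" by (simp add: R m_def K_def)
  have m: "real n \<le> m" "real n powr (3/2) * p \<le> m" by (auto simp: m_def)
  have pos: "0 < m * K" using n by (simp add: m_def K_def less_max_iff_disj)
  have "4 * (m * K) \<le> real d" using \<open>4 \<le> R\<close> pos by (simp add: R_eq pos_le_divide_eq)
  moreover have "real n * K \<le> m * K" using m(1) by (intro mult_right_mono) (auto simp: K_def)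
  ultimately have "4 * (real n * K) \<le> real d" by linarith
  then have "tv_rgg_gnp n d p \<le> 14 * (real n powr (3/2) * p * K / real d)"
    unfolding K_def by (intro tv_rgg_gnp_le n p)
  also have "\<dots> \<le> 14 * (m * K / real d)"
    using m(2) by (intro mult_left_mono divide_right_mono mult_right_mono) (auto simp: K_def)
  finally show ?thesis by (simp add: R_eq)
qed

theorem theorem1p2:
  shows "\<forall>\<delta>>0. \<forall>\<epsilon>>0. \<exists>C::real. \<forall>(p :: nat \<Rightarrow> real) (d :: nat \<Rightarrow> nat).
     ((\<forall>\<^sub>F n in sequentially.
         real n powr (-1 + \<epsilon>) \<le> p n \<and> p n \<le> 1/2 \<and> real n powr \<delta> \<le> real (d n))
      \<and> filterlim (\<lambda>n. real (d n) /
            (max (real n powr (3/2) * p n) (real n) * ln (real n) powr C)) at_top sequentially)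
     \<longrightarrow> ((\<lambda>n. tv_rgg_gnp n (d n) (p n)) \<longlonglongrightarrow> 0)"
proof (intro allI impI exI[of _ "3/2"], elim conjE)
  fix \<delta> \<epsilon> :: real and p :: "nat \<Rightarrow> real" and d :: "nat \<Rightarrow> nat"
  assume "0 < \<epsilon>" and regime: "\<forall>\<^sub>F n in sequentially.
      real n powr (-1 + \<epsilon>) \<le> p n \<and> p n \<le> 1/2 \<and> real n powr \<delta> \<le> real (d n)"
  define R where "R = (\<lambda>n. real (d n) /
      (max (real n powr (3/2) * p n) (real n) * ln (real n) powr (3/2)))"
  assume "filterlim (\<lambda>n. real (d n) /
      (max (real n powr (3/2) * p n) (real n) * ln (real n) powr (3/2))) at_top sequentially"
  then have R: "filterlim R at_top sequentially" by (simp add: R_def)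
  have upper: "\<forall>\<^sub>F n in sequentially. tv_rgg_gnp n (d n) (p n) \<le> 14 / R n"
    using regime filterlim_at_top[THEN iffD1, OF R, rule_format, of 4] eventually_ge_at_top[of 3]
  proof eventually_elim
    case (elim n)
    have "1 / real n = real n powr (- 1)" using elim by (simp add: powr_minus_divide)
    also have "\<dots> \<le> real n powr (-1 + \<epsilon>)" using elim \<open>0 < \<epsilon>\<close> by (intro powr_mono) auto
    finally show ?case using elim by (intro tv_rgg_gnp_le_inverse_ratio) (auto simp: R_def)
  qed
  have lower: "\<forall>\<^sub>F n in sequentially. 0 \<le> tv_rgg_gnp n (d n) (p n)"
    by (simp add: tv_rgg_gnp_def tv_fin_def sum_nonneg)
  have "(\<lambda>n. 14 / R n) \<longlonglongrightarrow> 0" by (rule real_tendsto_divide_at_top[OF tendsto_const R])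
  then show "(\<lambda>n. tv_rgg_gnp n (d n) (p n)) \<longlonglongrightarrow> 0"
    by (rule tendsto_sandwich[OF lower upper tendsto_const])
qed

end
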